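(* For every integer $m\ge1$ there exists a constant $C_m<\infty$, depending only on $m$, such that the following holds. Let $n\ge2$, let $\gamma:S^1\times[0,\omega)\to\mathbb{R}^n$ be a smooth solution of curve shortening flow, let $T=\partial\gamma/\partial s$ be its unit tangent vector and let $K_t:=\sup\kappa^2(\cdot,t)$. Then for all $t\in(0,\tfrac{1}{8K_0}]$ with $t<\omega$, everywhere on $S^1$, $$\left|\frac{\partial^m T}{\partial s^m}\right|^2\le\frac{C_mK_0}{t^{m-1}}.$$
   Context: A smooth family of immersions $\gamma:S^1\times[0,\omega)\to\mathbb{R}^n$ is a solution of curve shortening flow if $\partial\gamma/\partial t=\kappa N=\partial^2\gamma/\partial s^2$, where $\partial/\partial s=|\partial\gamma/\partial p|^{-1}\,\partial/\partial p$ is differentiation with respect to arclength of $\gamma(\cdot,t)$ ($\partial/\partial t$ is taken at fixed parameter $p\in S^1$), and $\kappa=|\partial^2\gamma/\partial s^2|$ is the curvature. *)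

theory Defs
  imports "HOL-Analysis.Analysis"
begin

text \<open>
  The dimension \<open>n\<close> of the ambient space has to be quantified inside the statement, since the
  constants must not depend on it. So \<open>\<real>\<^sup>n\<close> is the topological space
  \<^const>\<open>Euclidean_space\<close> \<open>n\<close> (the functions \<open>nat \<Rightarrow> real\<close> that vanish at all indices \<open>\<ge> n\<close>), the
  Euclidean norm is \<open>L2_set v {..<n}\<close>, and curves are differentiated coordinatewise.

  The circle \<open>S\<^sup>1\<close> is \<open>\<real> / 2\<pi>\<int>\<close>: a map on \<open>S\<^sup>1\<close> is a \<open>2\<pi>\<close>-periodic map on the reals, and
  \<open>\<gamma> p t\<close> is the point with parameter \<open>p\<close> at time \<open>t\<close>.
\<close>

text \<open>
  Functions of class \<open>C\<^sup>k\<close>. On a convex set \<open>S\<close> with nonempty interior, as used below, the derivative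
  within \<open>S\<close> is unique; at the boundary it is the one-sided derivative.
\<close>

primrec Ck_on :: "nat \<Rightarrow> ('a::euclidean_space) set \<Rightarrow> ('a \<Rightarrow> real) \<Rightarrow> bool" where
  "Ck_on 0 S f \<longleftrightarrow> continuous_on S f"
| "Ck_on (Suc k) S f \<longleftrightarrow>
     (\<exists>f'. (\<forall>x\<in>S. (f has_derivative f' x) (at x within S)) \<and> (\<forall>v. Ck_on k S (\<lambda>x. f' x v)))"

definition smooth_on :: "('a::euclidean_space) set \<Rightarrow> ('a \<Rightarrow> real) \<Rightarrow> bool" where
  "smooth_on S f \<longleftrightarrow> (\<forall>k. Ck_on k S f)"

definition coord_deriv :: "(real \<Rightarrow> nat \<Rightarrow> real) \<Rightarrow> real \<Rightarrow> nat \<Rightarrow> real" where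
  "coord_deriv c p = (\<lambda>i. deriv (\<lambda>q. c q i) p)"

definition speed :: "nat \<Rightarrow> (real \<Rightarrow> nat \<Rightarrow> real) \<Rightarrow> real \<Rightarrow> real" where
  "speed n c p = L2_set (coord_deriv c p) {..<n}"

text \<open>
  \<open>arc_deriv n c F\<close> is \<open>\<partial>F/\<partial>s\<close>, where \<open>s\<close> is the arclength of the curve \<open>c\<close> in \<open>\<real>\<^sup>n\<close>
  and \<open>F\<close> is a vector-valued function of the same parameter.
\<close>

definition arc_deriv ::
  "nat \<Rightarrow> (real \<Rightarrow> nat \<Rightarrow> real) \<Rightarrow> (real \<Rightarrow> nat \<Rightarrow> real) \<Rightarrow> real \<Rightarrow> nat \<Rightarrow> real" where
  "arc_deriv n c F p = (\<lambda>i. coord_deriv F p i / speed n c p)"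

definition unit_tangent :: "nat \<Rightarrow> (real \<Rightarrow> nat \<Rightarrow> real) \<Rightarrow> real \<Rightarrow> nat \<Rightarrow> real" where
  "unit_tangent n c = arc_deriv n c c"

definition curvature :: "nat \<Rightarrow> (real \<Rightarrow> nat \<Rightarrow> real) \<Rightarrow> real \<Rightarrow> real" where
  "curvature n c p = L2_set (arc_deriv n c (arc_deriv n c c) p) {..<n}"

definition max_curvature_sq :: "nat \<Rightarrow> (real \<Rightarrow> real \<Rightarrow> nat \<Rightarrow> real) \<Rightarrow> real \<Rightarrow> real" where
  "max_curvature_sq n \<gamma> t = (SUP p. (curvature n (\<lambda>q. \<gamma> q t) p)\<^sup>2)"

text \<open>The existence time \<open>\<omega>\<close> may be infinite.\<close>

definition time_interval :: "ereal \<Rightarrow> real set" where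
  "time_interval \<omega> = {t. 0 \<le> t \<and> ereal t < \<omega>}"

definition smooth_immersion_family ::
  "nat \<Rightarrow> ereal \<Rightarrow> (real \<Rightarrow> real \<Rightarrow> nat \<Rightarrow> real) \<Rightarrow> bool" where
  "smooth_immersion_family n \<omega> \<gamma> \<longleftrightarrow>
     (\<forall>t\<in>time_interval \<omega>. \<forall>p. \<gamma> p t \<in> topspace (Euclidean_space n)) \<and>
     (\<forall>t\<in>time_interval \<omega>. \<forall>p. \<gamma> (p + 2 * pi) t = \<gamma> p t) \<and>
     (\<forall>i<n. smooth_on (UNIV \<times> time_interval \<omega>) (\<lambda>(p, t). \<gamma> p t i)) \<and>
     (\<forall>t\<in>time_interval \<omega>. \<forall>p. \<exists>i<n. coord_deriv (\<lambda>q. \<gamma> q t) p i \<noteq> 0)"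

text \<open>At \<open>t = 0\<close> the time derivative is one-sided.\<close>

definition curve_shortening_flow ::
  "nat \<Rightarrow> ereal \<Rightarrow> (real \<Rightarrow> real \<Rightarrow> nat \<Rightarrow> real) \<Rightarrow> bool" where
  "curve_shortening_flow n \<omega> \<gamma> \<longleftrightarrow>
     0 < \<omega> \<and> smooth_immersion_family n \<omega> \<gamma> \<and>
     (\<forall>t\<in>time_interval \<omega>. \<forall>p. \<forall>i<n.
        ((\<lambda>\<tau>. \<gamma> p \<tau> i) has_real_derivative
           arc_deriv n (\<lambda>q. \<gamma> q t) (arc_deriv n (\<lambda>q. \<gamma> q t) (\<lambda>q. \<gamma> q t)) p i)
          (at t within time_interval \<omega>))"

end

theory Submission
  imports Defs
begin

text \<open>
  Write \<open>D\<^sub>j = \<partial>\<^sub>s\<^sup>j T\<close> and \<open>u\<^sub>j = |D\<^sub>j|\<^sup>2\<close>, and let \<open>K\<close> be the initial maximum of \<open>u\<^sub>1 = \<kappa>\<^sup>2\<close>. Since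
  \<open>\<partial>\<^sub>t \<partial>\<^sub>s = \<partial>\<^sub>s \<partial>\<^sub>t + \<kappa>\<^sup>2 \<partial>\<^sub>s\<close> along the flow, \<open>D\<^sub>j\<close> solves a heat equation
  \<open>\<partial>\<^sub>t D\<^sub>j = D\<^sub>j\<^sub>+\<^sub>2 + E\<^sub>j\<close>, where \<open>E\<^sub>j\<close> is a sum of terms \<open>\<langle>D\<^sub>a, D\<^sub>b\<rangle> D\<^sub>c\<close> with \<open>a, b \<ge> 1\<close> and
  \<open>a + b + c = j + 2\<close>. Hence \<open>\<partial>\<^sub>t u\<^sub>j = \<partial>\<^sub>s\<^sup>2 u\<^sub>j - 2 u\<^sub>j\<^sub>+\<^sub>1 + 2 \<langle>E\<^sub>j, D\<^sub>j\<rangle>\<close>, and all estimates come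
  from the maximum principle for periodic functions.

  The terms with \<open>c = 0\<close> carry the undifferentiated factor \<open>T\<close>, which does not scale like the others.
  But \<open>\<langle>T, D\<^sub>j\<rangle>\<close>, as seen by differentiating \<open>|T|\<^sup>2 = 1\<close>, is itself a sum of terms \<open>- \<langle>D\<^sub>a, D\<^sub>b\<rangle>\<close>
  with \<open>a, b \<ge> 1\<close> and \<open>a + b = j\<close>. So \<open>\<langle>E\<^sub>j, D\<^sub>j\<rangle>\<close> is bounded by products
  \<open>|D\<^sub>a| |D\<^sub>b| |D\<^sub>c| |D\<^sub>d|\<close> with all indices between \<open>1\<close> and \<open>j + 1\<close> and sum \<open>2 j + 2\<close>
  (\<open>reaction_ip_bound\<close>). The number of these products depends on \<open>j\<close> alone, which is why the
  constants depend neither on the curve nor on the dimension.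

  For \<open>j = 1\<close> one gets \<open>\<partial>\<^sub>t u\<^sub>1 \<le> \<partial>\<^sub>s\<^sup>2 u\<^sub>1 + 4 u\<^sub>1\<^sup>2\<close>, and comparison with the solution
  \<open>K / (1 - 4 K t)\<close> of the ordinary differential equation gives \<open>u\<^sub>1 \<le> 2 K\<close> up to time \<open>1 / (8 K)\<close>.

  Let now \<open>m \<ge> 2\<close> and suppose that \<open>u\<^sub>j \<le> C K / t\<^bsup>j-1\<^esup>\<close> for \<open>j < m\<close>. In a product as above that
  belongs to \<open>u\<^sub>m\<close>, the top index \<open>m + 1\<close> occurs at most once, and then all other indices are below
  \<open>m\<close>; otherwise at most two indices equal \<open>m\<close>, and if there are two, the others are \<open>1\<close>. Young's
  inequality thus absorbs \<open>u\<^sub>m\<^sub>+\<^sub>1\<close> into the good term and yields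
  \<open>\<partial>\<^sub>t u\<^sub>m \<le> \<partial>\<^sub>s\<^sup>2 u\<^sub>m - u\<^sub>m\<^sub>+\<^sub>1 + (B / t) u\<^sub>m + B K\<^sup>2 / t\<^bsup>m-1\<^esup>\<close> (\<open>dissipates_if_decays\<close>).
  The good term \<open>- u\<^sub>m\<close> in the inequality for \<open>u\<^sub>m\<^sub>-\<^sub>1\<close> pays for the bad terms of \<open>(\<tau> - t/2) u\<^sub>m\<close>, so the
  maximum principle on the time interval from \<open>t/2\<close> to \<open>t\<close>, applied to
  \<open>(\<tau> - t/2) u\<^sub>m + A u\<^sub>m\<^sub>-\<^sub>1\<close> with a large \<open>A\<close>, bounds \<open>u\<^sub>m\<close> at time \<open>t\<close> (\<open>decays_step\<close>).
\<close>

section \<open>Calculus of smooth functions of space and time\<close>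

lemma Ck_on_cong:
  assumes "Ck_on k S f" "\<And>x. x \<in> S \<Longrightarrow> f x = g x"
  shows "Ck_on k S g"
  using assms
proof (cases k)
  case 0
  then show ?thesis using assms continuous_on_cong[of S S f g] by simp
next
  case (Suc l)
  then obtain f' where f': "\<forall>x\<in>S. (f has_derivative f' x) (at x within S)"
    "\<forall>v. Ck_on l S (\<lambda>x. f' x v)"
    using assms(1) by auto
  have "(g has_derivative f' x) (at x within S)" if "x \<in> S" for x
    by (rule has_derivative_transform[OF that _ f'(1)[rule_format, OF that]]) (simp add: assms(2))
  then show ?thesis unfolding Suc using f'(2) by auto
qed

lemma Ck_on_lower: "Ck_on (Suc k) S f \<Longrightarrow> Ck_on k S f"
proof (induction k arbitrary: f)
  case 0
  then obtain f' where "\<forall>x\<in>S. (f has_derivative f' x) (at x within S)"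
    by auto
  then have "continuous_on S f" by (auto intro: has_derivative_continuous_on)
  then show ?case by simp
next
  case (Suc k)
  from Suc.prems obtain f' where "\<forall>x\<in>S. (f has_derivative f' x) (at x within S)"
    "\<forall>v. Ck_on (Suc k) S (\<lambda>x. f' x v)" by (subst (asm) Ck_on.simps(2)) blast
  with Suc.IH show ?case by auto
qed

lemma Ck_on_const: "Ck_on k S (\<lambda>x. c)"
proof (induction k arbitrary: c)
  case (Suc k)
  have "(\<forall>x\<in>S. ((\<lambda>x. c) has_derivative (\<lambda>x v. 0) x) (at x within S)) \<and> (\<forall>v. Ck_on k S (\<lambda>x. 0))"
    using Suc by auto
  then show ?case unfolding Ck_on.simps by (intro exI)
qed auto

text \<open>
  The derivatives in the definition of \<open>Ck_on\<close> are existentially quantified, so the closure properties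
  hold on arbitrary sets; each is an induction that takes the derivative from the usual rule and
  lowers the regularity of the undifferentiated factors by \<open>Ck_on_lower\<close>.
\<close>
lemma Ck_on_add:
  assumes "Ck_on k S f" "Ck_on k S g"
  shows "Ck_on k S (\<lambda>x. f x + g x)"
  using assms
proof (induction k arbitrary: f g)
  case 0
  then show ?case by (auto intro: continuous_on_add)
next
  case (Suc k)
  from Suc.prems obtain f' g' where
    "\<forall>x\<in>S. (f has_derivative f' x) (at x within S)" "\<forall>v. Ck_on k S (\<lambda>x. f' x v)"
    "\<forall>x\<in>S. (g has_derivative g' x) (at x within S)" "\<forall>v. Ck_on k S (\<lambda>x. g' x v)"
    by auto
  with Suc.IH show ?case
    unfolding Ck_on.simps
    by (intro exI[of _ "\<lambda>x v. f' x v + g' x v"]) (auto intro: has_derivative_add)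
qed

lemma Ck_on_mult:
  assumes "Ck_on k S f" "Ck_on k S g"
  shows "Ck_on k S (\<lambda>x. f x * g x)"
  using assms
proof (induction k arbitrary: f g)
  case 0
  then show ?case by (auto intro: continuous_on_mult)
next
  case (Suc k)
  from Suc.prems obtain f' g' where *:
    "\<forall>x\<in>S. (f has_derivative f' x) (at x within S)" "\<forall>v. Ck_on k S (\<lambda>x. f' x v)"
    "\<forall>x\<in>S. (g has_derivative g' x) (at x within S)" "\<forall>v. Ck_on k S (\<lambda>x. g' x v)"
    by auto
  have "Ck_on k S f" "Ck_on k S g" using Suc.prems Ck_on_lower by blast+
  with * Suc.IH show ?case
    unfolding Ck_on.simps
    by (intro exI[of _ "\<lambda>x v. f x * g' x v + f' x v * g x"])
      (auto intro!: has_derivative_mult Ck_on_add)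
qed

lemma Ck_on_inverse:
  assumes "Ck_on k S f" "\<And>x. x \<in> S \<Longrightarrow> f x \<noteq> 0"
  shows "Ck_on k S (\<lambda>x. inverse (f x))"
  using assms(1)
proof (induction k)
  case 0
  then show ?case using assms(2) by (auto intro!: continuous_on_inverse)
next
  case (Suc k)
  from Suc.prems obtain f' where *:
    "\<forall>x\<in>S. (f has_derivative f' x) (at x within S)" "\<forall>v. Ck_on k S (\<lambda>x. f' x v)"
    by auto
  have inv: "Ck_on k S (\<lambda>x. inverse (f x))" using Suc Ck_on_lower by blast
  have "Ck_on k S (\<lambda>x. (- 1) * (inverse (f x) * f' x v * inverse (f x)))" for v
    by (intro Ck_on_mult Ck_on_const inv *(2)[rule_format])
  then show ?case
    unfolding Ck_on.simps using *(1) assms(2)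
    by (intro exI[of _ "\<lambda>x v. - (inverse (f x) * f' x v * inverse (f x))"])
      (auto intro!: has_derivative_inverse)
qed

lemma Ck_on_sqrt:
  assumes "Ck_on k S f" "\<And>x. x \<in> S \<Longrightarrow> f x > 0"
  shows "Ck_on k S (\<lambda>x. sqrt (f x))"
  using assms(1)
proof (induction k)
  case 0
  then show ?case by (auto intro!: continuous_on_real_sqrt)
next
  case (Suc k)
  from Suc.prems obtain f' where *:
    "\<forall>x\<in>S. (f has_derivative f' x) (at x within S)" "\<forall>v. Ck_on k S (\<lambda>x. f' x v)"
    by auto
  have root: "Ck_on k S (\<lambda>x. sqrt (f x))" using Suc Ck_on_lower by blast
  have "Ck_on k S (\<lambda>x. f' x v * inverse (2 * sqrt (f x)))" for v
    using assms(2) by (intro Ck_on_mult Ck_on_const root *(2)[rule_format] Ck_on_inverse) force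
  moreover have "((\<lambda>x. sqrt (f x)) has_derivative (\<lambda>v. f' x v * inverse (2 * sqrt (f x)))) (at x within S)"
    if "x \<in> S" for x
    using has_derivative_real_sqrt[OF assms(2)[OF that] *(1)[rule_format, OF that]]
    by (simp add: field_simps)
  ultimately show ?case
    unfolding Ck_on.simps
    by (intro exI[of _ "\<lambda>x v. f' x v * inverse (2 * sqrt (f x))"]) auto
qed

text \<open>
  Functions of a space variable \<open>p\<close> and a time \<open>t\<close> are curried, so that both partial
  functions can be differentiated directly. The time interval \<open>I\<close> may contain its left end point.
\<close>
definition spacetime_smooth :: "real set \<Rightarrow> (real \<Rightarrow> real \<Rightarrow> real) \<Rightarrow> bool" where
  "spacetime_smooth I F \<longleftrightarrow> smooth_on (UNIV \<times> I) (\<lambda>x. F (fst x) (snd x))"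

lemma spacetime_smooth_const: "spacetime_smooth I (\<lambda>p t. c)"
  by (simp add: spacetime_smooth_def smooth_on_def Ck_on_const)

lemma spacetime_smooth_add:
  "spacetime_smooth I F \<Longrightarrow> spacetime_smooth I G \<Longrightarrow> spacetime_smooth I (\<lambda>p t. F p t + G p t)"
  by (simp add: spacetime_smooth_def smooth_on_def Ck_on_add)

lemma spacetime_smooth_mult:
  "spacetime_smooth I F \<Longrightarrow> spacetime_smooth I G \<Longrightarrow> spacetime_smooth I (\<lambda>p t. F p t * G p t)"
  by (simp add: spacetime_smooth_def smooth_on_def Ck_on_mult)

lemma spacetime_smooth_inverse:
  assumes "spacetime_smooth I F" "\<And>p t. t \<in> I \<Longrightarrow> F p t \<noteq> 0"
  shows "spacetime_smooth I (\<lambda>p t. inverse (F p t))"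
  using assms unfolding spacetime_smooth_def smooth_on_def by (auto intro!: Ck_on_inverse)

lemma spacetime_smooth_sqrt:
  assumes "spacetime_smooth I F" "\<And>p t. t \<in> I \<Longrightarrow> F p t > 0"
  shows "spacetime_smooth I (\<lambda>p t. sqrt (F p t))"
  using assms unfolding spacetime_smooth_def smooth_on_def by (auto intro!: Ck_on_sqrt)

lemma spacetime_smooth_sum:
  assumes "\<And>i. i \<in> A \<Longrightarrow> spacetime_smooth I (F i)"
  shows "spacetime_smooth I (\<lambda>p t. \<Sum>i\<in>A. F i p t)"
  using assms
  by (induction A rule: infinite_finite_induct)
    (auto intro: spacetime_smooth_const spacetime_smooth_add)

lemma spacetime_smooth_continuous_on:
  assumes "spacetime_smooth I F"
  shows "continuous_on (UNIV \<times> I) (\<lambda>x. F (fst x) (snd x))"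
  using assms unfolding spacetime_smooth_def smooth_on_def by (metis Ck_on.simps(1))

text \<open>
  The line of constant time through a point lies in \<open>UNIV \<times> I\<close> even at a boundary time, so the total
  derivative determines the space derivative there.
\<close>
lemma spacetime_derivative_slice:
  assumes F: "((\<lambda>x. F (fst x) (snd x)) has_derivative f') (at (p, t) within UNIV \<times> I)"
    and t: "t \<in> I"
  shows "((\<lambda>q. F q t) has_real_derivative f' (1, 0)) (at p)"
proof -
  have "((\<lambda>x. F (fst x) (snd x)) has_derivative f') (at (p, t) within (\<lambda>q. (q, t)) ` UNIV)"
    by (rule has_derivative_subset[OF F]) (use t in auto)
  moreover have "((\<lambda>q. (q, t)) has_derivative (\<lambda>h. (h, 0))) (at p)"
    by (rule has_derivative_Pair[OF has_derivative_ident has_derivative_const])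
  ultimately have slice: "((\<lambda>q. F q t) has_derivative (\<lambda>h. f' (h, 0))) (at p)"
    using has_derivative_in_compose[of "\<lambda>q. (q, t)" "\<lambda>h. (h, 0)" p UNIV "\<lambda>x. F (fst x) (snd x)" f']
    by simp
  have "(\<lambda>h. f' (h, 0)) = (*) (f' (1, 0))"
  proof
    show "f' (h, 0) = f' (1, 0) * h" for h
      using linear_scale[OF has_derivative_linear[OF F], of h "(1, 0)"] by (simp add: mult.commute)
  qed
  from has_derivative_eq_rhs[OF slice this] show ?thesis
    unfolding has_field_derivative_def .
qed

lemma spacetime_smooth_deriv:
  assumes "spacetime_smooth I F"
  shows "spacetime_smooth I (\<lambda>p t. deriv (\<lambda>q. F q t) p)"
  unfolding spacetime_smooth_def smooth_on_def
proof
  fix k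
  from assms have "Ck_on (Suc k) (UNIV \<times> I) (\<lambda>x. F (fst x) (snd x))"
    by (simp only: spacetime_smooth_def smooth_on_def)
  then obtain f' where f': "\<forall>x\<in>UNIV \<times> I. ((\<lambda>x. F (fst x) (snd x)) has_derivative f' x) (at x within UNIV \<times> I)"
    "\<forall>v. Ck_on k (UNIV \<times> I) (\<lambda>x. f' x v)" by auto
  show "Ck_on k (UNIV \<times> I) (\<lambda>x. deriv (\<lambda>q. F q (snd x)) (fst x))"
  proof (rule Ck_on_cong[OF f'(2)[rule_format, of "(1, 0)"]])
    fix x :: "real \<times> real" assume "x \<in> UNIV \<times> I"
    then show "f' x (1, 0) = deriv (\<lambda>q. F q (snd x)) (fst x)"
      using f'(1) spacetime_derivative_slice[of F "f' x" "fst x" "snd x" I]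
      by (auto intro!: DERIV_imp_deriv[symmetric])
  qed
qed

lemma spacetime_smooth_has_deriv:
  assumes "spacetime_smooth I F" "t \<in> I"
  shows "((\<lambda>q. F q t) has_real_derivative deriv (\<lambda>q. F q t) p) (at p)"
proof -
  from assms(1) have "Ck_on (Suc 0) (UNIV \<times> I) (\<lambda>x. F (fst x) (snd x))"
    by (simp only: spacetime_smooth_def smooth_on_def)
  then obtain f' where "((\<lambda>x. F (fst x) (snd x)) has_derivative f') (at (p, t) within UNIV \<times> I)"
    using assms(2) by auto
  from spacetime_derivative_slice[OF this assms(2)] show ?thesis
    by (simp add: DERIV_imp_deriv)
qed

lemma spacetime_smooth_continuous_in_time:
  assumes "spacetime_smooth I F"
  shows "continuous_on I (F p)"
  by (rule continuous_on_compose2[OF spacetime_smooth_continuous_on[OF assms], of I "\<lambda>t. (p, t)", simplified])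
    (auto intro!: continuous_intros)

text \<open>
  The exchange of the derivatives in \<open>p\<close> and \<open>t\<close>, when the time derivative \<open>X\<close> is known to be
  smooth: integrate \<open>X\<close> in time, differentiate under the integral in \<open>p\<close>, and
  differentiate the resulting integral in time.
\<close>
lemma time_derivative_of_space_derivative:
  assumes F: "spacetime_smooth I F" and X: "spacetime_smooth I X"
    and ab: "{a..b} \<subseteq> I"
    and dt: "\<And>p t. t \<in> {a..b} \<Longrightarrow> (F p has_real_derivative X p t) (at t within {a..b})"
    and t: "t \<in> {a<..<b}"
  shows "((\<lambda>t. deriv (\<lambda>q. F q t) p) has_real_derivative deriv (\<lambda>q. X q t) p) (at t)"
proof -
  define Fp where "Fp = (\<lambda>p t. deriv (\<lambda>q. F q t) p)"
  define Xp where "Xp = (\<lambda>p t. deriv (\<lambda>q. X q t) p)"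
  have Xp: "spacetime_smooth I Xp"
    unfolding Xp_def by (rule spacetime_smooth_deriv[OF X])
  have FTC: "F q \<tau> = F q a + integral {a..\<tau>} (X q)" if "\<tau> \<in> {a..b}" for q \<tau>
  proof -
    have "(X q has_integral (F q \<tau> - F q a)) {a..\<tau>}"
      using that
      by (intro fundamental_theorem_of_calculus)
        (auto simp flip: has_real_derivative_iff_has_vector_derivative intro!: DERIV_subset[OF dt])
    then show ?thesis by (simp add: integral_unique)
  qed
  have eq: "Fp p \<tau> = Fp p a + integral {a..\<tau>} (Xp p)" if \<tau>: "\<tau> \<in> {a..b}" for \<tau>
  proof -
    have "((\<lambda>q. integral (cbox a \<tau>) (X q)) has_field_derivative integral (cbox a \<tau>) (Xp p)) (at p within UNIV)"
    proof (rule leibniz_rule_field_derivative)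
      fix q s assume "s \<in> cbox a \<tau>"
      then show "((\<lambda>q. X q s) has_field_derivative Xp q s) (at q within UNIV)"
        unfolding Xp_def using ab \<tau> by (intro spacetime_smooth_has_deriv[OF X]) auto
    next
      fix q
      show "X q integrable_on cbox a \<tau>"
        using ab \<tau>
        by (intro integrable_continuous continuous_on_subset[OF spacetime_smooth_continuous_in_time[OF X]])
          auto
    next
      show "continuous_on (UNIV \<times> cbox a \<tau>) (\<lambda>(q, s). Xp q s)"
        unfolding case_prod_beta using ab \<tau>
        by (intro continuous_on_subset[OF spacetime_smooth_continuous_on[OF Xp]]) auto
    qed auto
    then have "((\<lambda>q. F q a + integral {a..\<tau>} (X q)) has_real_derivative
        Fp p a + integral {a..\<tau>} (Xp p)) (at p)"
      unfolding Fp_def using ab \<tau>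
      by (intro DERIV_add spacetime_smooth_has_deriv[OF F]) auto
    then have "((\<lambda>q. F q \<tau>) has_real_derivative Fp p a + integral {a..\<tau>} (Xp p)) (at p)"
      using FTC[OF \<tau>] by simp
    from DERIV_imp_deriv[OF this] show ?thesis by (simp add: Fp_def)
  qed
  have "((\<lambda>\<tau>. Fp p a + integral {a..\<tau>} (Xp p)) has_real_derivative Xp p t) (at t within {a..b})"
    using t ab
    by (auto intro!: derivative_eq_intros integral_has_real_derivative
        continuous_on_subset[OF spacetime_smooth_continuous_in_time[OF Xp]])
  then have "(Fp p has_real_derivative Xp p t) (at t within {a..b})"
    unfolding has_field_derivative_def
    by (rule has_derivative_transform[rotated 2]) (use t in \<open>auto intro: eq\<close>)
  moreover have "at t within {a..b} = at t"
    using t by (intro at_within_interior) auto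
  ultimately show ?thesis by (simp add: Fp_def Xp_def)
qed

section \<open>The maximum principle for periodic functions\<close>

text \<open>
  The second derivative test for the derivation \<open>v\<^sup>-\<^sup>1 d/dq\<close>, which is differentiation by arclength
  when \<open>v\<close> is the speed; \<open>f1\<close> and \<open>f2\<close> are the first two such derivatives of \<open>f\<close>. If \<open>f2 > 0\<close>,
  then \<open>f1\<close> is positive and \<open>f\<close> increases to the right of the maximum.
\<close>
lemma second_derivative_nonpos_at_max:
  fixes f f1 :: "real \<Rightarrow> real"
  assumes v: "\<And>q. v q > 0"
    and f: "\<And>q. (f has_real_derivative v q * f1 q) (at q)"
    and f1: "(f1 has_real_derivative v p * f2) (at p)"
    and mx: "\<And>q. f q \<le> f p"
  shows "f2 \<le> 0"
proof (rule ccontr)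
  assume "\<not> f2 \<le> 0"
  then have "v p * f2 > 0" using v by simp
  from DERIV_pos_inc_right[OF f1 this] obtain d where d: "d > 0" "\<And>h. 0 < h \<Longrightarrow> h < d \<Longrightarrow> f1 p < f1 (p + h)"
    by auto
  have "v p * f1 p = 0"
    by (rule DERIV_local_max[OF f zero_less_one]) (use mx in auto)
  then have "f1 p = 0" using v[of p] by simp
  obtain z where z: "p < z" "z < p + d/2" "f (p + d/2) - f p = (p + d/2 - p) * (v z * f1 z)"
    using MVT2[of p "p + d/2" f "\<lambda>q. v q * f1 q"] f d(1) by auto
  have "f1 z > 0" using d(2)[of "z - p"] z \<open>f1 p = 0\<close> d(1) by simp
  then have "f (p + d/2) - f p > 0" unfolding z(3) using v[of z] d(1) by simp
  with mx[of "p + d/2"] show False by simp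
qed

lemma has_real_derivative_nonneg_at_left_max:
  fixes g :: "real \<Rightarrow> real"
  assumes "(g has_real_derivative D) (at t)" "a < t" "\<And>s. a \<le> s \<Longrightarrow> s \<le> t \<Longrightarrow> g s \<le> g t"
  shows "D \<ge> 0"
proof (rule ccontr)
  assume "\<not> D \<ge> 0"
  then have "D < 0" by simp
  from DERIV_neg_dec_left[OF assms(1) this] obtain d where d: "d > 0" "\<And>h. 0 < h \<Longrightarrow> h < d \<Longrightarrow> g t < g (t - h)"
    by auto
  define h where "h = min (d/2) (t - a)"
  have "0 < h" "h < d" "a \<le> t - h" using d(1) assms(2) by (auto simp: h_def)
  with d(2)[of h] assms(3)[of "t - h"] show False by simp
qed

lemma periodic_value_on_fundamental_interval:
  fixes f :: "real \<Rightarrow> 'a"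
  assumes "\<And>p. f (p + 2 * pi) = f p"
  shows "\<exists>q\<in>{0..2 * pi}. f q = f p"
proof -
  interpret periodic_fun_simple f "2 * pi" by unfold_locales (rule assms)
  define k where "k = \<lfloor>p / (2 * pi)\<rfloor>"
  have "f (p - of_int k * (2 * pi)) = f p" by (rule minus_of_int)
  moreover have "of_int k \<le> p / (2 * pi)" "p / (2 * pi) < of_int k + 1" unfolding k_def by linarith+
  then have "p - of_int k * (2 * pi) \<in> {0..2 * pi}" by (auto simp: field_simps)
  ultimately show ?thesis by blast
qed

text \<open>
  A positive value would make the maximum of \<open>exp (- (\<Lambda> + 1) t) f\<close>, which exists by periodicity,
  positive and hence attained after time \<open>a\<close>. At that point \<open>f\<close> is maximal in space, and the
  exponential factor turns the assumed bound \<open>D \<le> \<Lambda> f\<close> into a negative time derivative, although the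
  time derivative cannot be negative where no earlier value is larger.
\<close>
lemma periodic_maximum_principle:
  fixes f :: "real \<Rightarrow> real \<Rightarrow> real"
  assumes cont: "continuous_on (UNIV \<times> {a..b}) (\<lambda>x. f (fst x) (snd x))"
    and per: "\<And>p t. t \<in> {a..b} \<Longrightarrow> f (p + 2 * pi) t = f p t"
    and init: "\<And>p. f p a \<le> 0"
    and dt: "\<And>p t. a < t \<Longrightarrow> t \<le> b \<Longrightarrow> f p t > 0 \<Longrightarrow> (\<And>q. f q t \<le> f p t) \<Longrightarrow>
       \<exists>D. (f p has_real_derivative D) (at t) \<and> D \<le> \<Lambda> * f p t"
    and t: "t \<in> {a..b}"
  shows "f p t \<le> 0"
proof (rule ccontr)
  assume pos: "\<not> f p t \<le> 0"
  define g where "g = (\<lambda>p t. exp (- (\<Lambda> + 1) * t) * f p t)"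
  have gper: "g (q + 2 * pi) s = g q s" if "s \<in> {a..b}" for q s
    using per[OF that] by (simp add: g_def)
  have "continuous_on ({0..2*pi} \<times> {a..b}) (\<lambda>x. g (fst x) (snd x))"
    unfolding g_def
    by (intro continuous_intros continuous_on_subset[OF cont]) auto
  moreover have "{0..2*pi} \<times> {a..b} \<noteq> {}" using t by auto
  moreover have "compact ({0..2*pi} \<times> {a..b})" by (intro compact_Times compact_Icc)
  ultimately obtain x where x: "x \<in> {0..2*pi} \<times> {a..b}"
    "\<And>y. y \<in> {0..2*pi} \<times> {a..b} \<Longrightarrow> g (fst y) (snd y) \<le> g (fst x) (snd x)"
    using continuous_attains_sup[of "{0..2*pi} \<times> {a..b}" "\<lambda>x. g (fst x) (snd x)"] by blast
  define q s where "q = fst x" and "s = snd x"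
  have s: "s \<in> {a..b}" using x(1) by (auto simp: s_def)
  have mx: "g r \<tau> \<le> g q s" if \<tau>: "\<tau> \<in> {a..b}" for r \<tau>
  proof -
    obtain r' where "r' \<in> {0..2*pi}" "g r' \<tau> = g r \<tau>"
      using periodic_value_on_fundamental_interval[of "\<lambda>p. g p \<tau>" r] gper[OF \<tau>] by auto
    then show ?thesis using x(2)[of "(r', \<tau>)"] \<tau> by (auto simp: q_def s_def)
  qed
  have "g p t > 0" using pos by (simp add: g_def)
  with mx[OF t, of p] have "g q s > 0" by linarith
  then have fpos: "f q s > 0" by (simp add: g_def zero_less_mult_iff)
  then have "s \<noteq> a" using init[of q] by auto
  then have "a < s" using s by auto
  have "f r s \<le> f q s" for r
    using mx[OF s, of r] by (simp add: g_def)
  then obtain D where D: "(f q has_real_derivative D) (at s)" "D \<le> \<Lambda> * f q s"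
    using dt[of s q] \<open>a < s\<close> s fpos by auto
  have "(g q has_real_derivative exp (- (\<Lambda> + 1) * s) * (D - (\<Lambda> + 1) * f q s)) (at s)"
    unfolding g_def
    by (auto intro!: derivative_eq_intros D(1) simp: algebra_simps)
  from has_real_derivative_nonneg_at_left_max[OF this \<open>a < s\<close>] mx s
  have "exp (- (\<Lambda> + 1) * s) * (D - (\<Lambda> + 1) * f q s) \<ge> 0" by auto
  then have "D - (\<Lambda> + 1) * f q s \<ge> 0" by (simp add: zero_le_mult_iff)
  with D(2) fpos show False by (simp add: algebra_simps)
qed

section \<open>The nonlinear terms of the evolution equations\<close>

lemma has_real_derivative_sum_list:
  assumes "\<And>x. x \<in> set xs \<Longrightarrow> (f x has_real_derivative f' x) F"
  shows "((\<lambda>q. \<Sum>x\<leftarrow>xs. f x q) has_real_derivative (\<Sum>x\<leftarrow>xs. f' x)) F"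
  using assms by (induction xs) (auto intro!: derivative_eq_intros)

lemma sum_list_concat_map:
  fixes f :: "'b \<Rightarrow> 'c::comm_monoid_add"
  shows "(\<Sum>y\<leftarrow>concat (map g xs). f y) = (\<Sum>x\<leftarrow>xs. \<Sum>y\<leftarrow>g x. f y)"
  by (induction xs) auto

text \<open>
  An entry \<open>(a, b, c)\<close> stands for \<open>\<langle>D\<^sub>a, D\<^sub>b\<rangle> D\<^sub>c\<close>. Applying \<open>\<partial>\<^sub>s\<close> to \<open>E\<^sub>j\<close> raises one of the three
  indices by the product rule, and exchanging \<open>\<partial>\<^sub>t\<close> and \<open>\<partial>\<^sub>s\<close> adds \<open>\<langle>D\<^sub>1, D\<^sub>1\<rangle> D\<^sub>j\<^sub>+\<^sub>1\<close>. The lists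
  record the terms with multiplicity, so that their lengths count them.
\<close>
primrec reaction_terms :: "nat \<Rightarrow> (nat \<times> nat \<times> nat) list" where
  "reaction_terms 0 = [(1, 1, 0)]"
| "reaction_terms (Suc j) = (1, 1, Suc j) #
     concat (map (\<lambda>(a, b, c). [(Suc a, b, c), (a, Suc b, c), (a, b, Suc c)]) (reaction_terms j))"

text \<open>
  An entry \<open>(a, b)\<close> stands for \<open>\<langle>D\<^sub>a, D\<^sub>b\<rangle>\<close> in the expansion of \<open>- \<langle>T, D\<^sub>j\<rangle>\<close>. The recursion is
  \<open>\<langle>T, D\<^sub>j\<^sub>+\<^sub>1\<rangle> = \<partial>\<^sub>s \<langle>T, D\<^sub>j\<rangle> - \<langle>D\<^sub>1, D\<^sub>j\<rangle>\<close>, which starts with \<open>\<langle>T, D\<^sub>1\<rangle> = 0\<close>; as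
  \<open>|T|\<^sup>2 = 1\<close> has no such expansion, the list for \<open>j = 0\<close> is a placeholder.
\<close>
primrec tangential_terms :: "nat \<Rightarrow> (nat \<times> nat) list" where
  "tangential_terms 0 = []"
| "tangential_terms (Suc j) = (if j = 0 then [] else
     (1, j) # concat (map (\<lambda>(a, b). [(Suc a, b), (a, Suc b)]) (tangential_terms j)))"

lemma reaction_terms_weight:
  "(a, b, c) \<in> set (reaction_terms j) \<Longrightarrow> 1 \<le> a \<and> 1 \<le> b \<and> a + b + c = j + 2"
  by (induction j arbitrary: a b c) auto

lemma tangential_terms_weight:
  "(a, b) \<in> set (tangential_terms j) \<Longrightarrow> 1 \<le> a \<and> 1 \<le> b \<and> a + b = j"
  by (induction j arbitrary: a b) (auto split: if_splits)

section \<open>Evolution equations along the flow\<close>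

locale closed_curve_flow =
  fixes n :: nat and \<omega> :: ereal and \<gamma> :: "real \<Rightarrow> real \<Rightarrow> nat \<Rightarrow> real"
  assumes flow: "curve_shortening_flow n \<omega> \<gamma>"
begin

abbreviation I :: "real set" where "I \<equiv> time_interval \<omega>"

text \<open>
  In the names below, \<open>v\<close> is the speed \<open>|\<partial>\<gamma>/\<partial>p|\<close>, \<open>ds\<close> is \<open>\<partial>/\<partial>s\<close> for scalar functions, \<open>D j i\<close> is
  the \<open>i\<close>-th coordinate of \<open>\<partial>\<^sub>s\<^sup>j T\<close>, and \<open>ip a b\<close> is the inner product of \<open>\<partial>\<^sub>s\<^sup>a T\<close> and \<open>\<partial>\<^sub>s\<^sup>b T\<close>.
\<close>
definition v :: "real \<Rightarrow> real \<Rightarrow> real" where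
  "v p t = speed n (\<lambda>q. \<gamma> q t) p"

definition ds :: "(real \<Rightarrow> real \<Rightarrow> real) \<Rightarrow> real \<Rightarrow> real \<Rightarrow> real" where
  "ds F p t = deriv (\<lambda>q. F q t) p / v p t"

definition D :: "nat \<Rightarrow> nat \<Rightarrow> real \<Rightarrow> real \<Rightarrow> real" where
  "D j i p t = (arc_deriv n (\<lambda>q. \<gamma> q t) ^^ j) (unit_tangent n (\<lambda>q. \<gamma> q t)) p i"

definition ip :: "nat \<Rightarrow> nat \<Rightarrow> real \<Rightarrow> real \<Rightarrow> real" where
  "ip a b p t = (\<Sum>i<n. D a i p t * D b i p t)"

definition reaction :: "nat \<Rightarrow> nat \<Rightarrow> real \<Rightarrow> real \<Rightarrow> real" where
  "reaction j i p t = (\<Sum>(a, b, c)\<leftarrow>reaction_terms j. ip a b p t * D c i p t)"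

lemma D_0: "D 0 i = ds (\<lambda>p t. \<gamma> p t i)"
  by (intro ext) (simp add: D_def ds_def v_def unit_tangent_def arc_deriv_def coord_deriv_def)

lemma D_Suc: "D (Suc j) i = ds (D j i)"
  by (intro ext) (simp add: D_def ds_def v_def arc_deriv_def coord_deriv_def)

lemma D_1: "D 1 i p t = arc_deriv n (\<lambda>q. \<gamma> q t) (arc_deriv n (\<lambda>q. \<gamma> q t) (\<lambda>q. \<gamma> q t)) p i"
  by (simp add: D_def unit_tangent_def)

lemma ip_commute: "ip a b = ip b a"
  by (intro ext) (simp add: ip_def mult.commute)

lemma ip_nonneg: "0 \<le> ip j j p t"
  by (simp add: ip_def sum_nonneg)

lemma smooth_\<gamma>: "i < n \<Longrightarrow> spacetime_smooth I (\<lambda>p t. \<gamma> p t i)"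
  using flow unfolding curve_shortening_flow_def smooth_immersion_family_def spacetime_smooth_def
  by (simp add: case_prod_beta')

lemma v_eq: "v p t = sqrt (\<Sum>i<n. (deriv (\<lambda>q. \<gamma> q t i) p)\<^sup>2)"
  by (simp add: v_def speed_def L2_set_def coord_deriv_def)

lemma speed_sq_pos:
  assumes "t \<in> I"
  shows "(\<Sum>i<n. (deriv (\<lambda>q. \<gamma> q t i) p)\<^sup>2) > 0"
proof -
  from flow assms obtain i where "i < n" "deriv (\<lambda>q. \<gamma> q t i) p \<noteq> 0"
    unfolding curve_shortening_flow_def smooth_immersion_family_def coord_deriv_def by blast
  then show ?thesis by (intro sum_pos2[where i = i]) auto
qed

lemma v_pos: "t \<in> I \<Longrightarrow> v p t > 0"
  using speed_sq_pos by (simp add: v_eq)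

lemma smooth_v: "spacetime_smooth I v"
proof -
  have "spacetime_smooth I (\<lambda>p t. sqrt (\<Sum>i<n. deriv (\<lambda>q. \<gamma> q t i) p * deriv (\<lambda>q. \<gamma> q t i) p))"
    by (intro spacetime_smooth_sqrt spacetime_smooth_sum spacetime_smooth_mult
        spacetime_smooth_deriv smooth_\<gamma>)
      (use speed_sq_pos in \<open>auto simp: power2_eq_square\<close>)
  moreover have "v = (\<lambda>p t. sqrt (\<Sum>i<n. deriv (\<lambda>q. \<gamma> q t i) p * deriv (\<lambda>q. \<gamma> q t i) p))"
    by (intro ext) (simp add: v_eq power2_eq_square)
  ultimately show ?thesis by simp
qed

lemma smooth_ds:
  assumes "spacetime_smooth I F"
  shows "spacetime_smooth I (ds F)"
proof -
  have "spacetime_smooth I (\<lambda>p t. deriv (\<lambda>q. F q t) p * inverse (v p t))"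
    using v_pos by (intro spacetime_smooth_mult spacetime_smooth_deriv assms spacetime_smooth_inverse smooth_v)
      (metis less_irrefl)
  then show ?thesis by (simp add: ds_def[abs_def] divide_inverse)
qed

lemma smooth_D: "i < n \<Longrightarrow> spacetime_smooth I (D j i)"
  by (induction j) (auto simp only: D_0 D_Suc intro: smooth_ds smooth_\<gamma>)

lemma smooth_ip: "spacetime_smooth I (ip a b)"
  unfolding ip_def[abs_def]
  by (intro spacetime_smooth_sum spacetime_smooth_mult smooth_D) auto

lemma smooth_reaction: 
  assumes "i < n"
  shows "spacetime_smooth I (reaction j i)"
proof -
  have "spacetime_smooth I (\<lambda>p t. \<Sum>(a, b, c)\<leftarrow>xs. ip a b p t * D c i p t)" for xs
    by (induction xs)
      (auto intro!: spacetime_smooth_const spacetime_smooth_add spacetime_smooth_mult smooth_ip smooth_D assms)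
  then show ?thesis by (simp add: reaction_def[abs_def])
qed

lemma ds_has_deriv:
  assumes "spacetime_smooth I F" "t \<in> I"
  shows "((\<lambda>q. F q t) has_real_derivative v p t * ds F p t) (at p)"
  using spacetime_smooth_has_deriv[OF assms] v_pos[OF assms(2), of p] by (simp add: ds_def)

lemma ds_eqI:
  assumes "((\<lambda>q. F q t) has_real_derivative v p t * y) (at p)" "t \<in> I"
  shows "ds F p t = y"
  using DERIV_imp_deriv[OF assms(1)] v_pos[OF assms(2), of p] by (simp add: ds_def)

lemma D_has_deriv:
  "i < n \<Longrightarrow> t \<in> I \<Longrightarrow> ((\<lambda>q. D j i q t) has_real_derivative v p t * D (Suc j) i p t) (at p)"
  unfolding D_Suc by (intro ds_has_deriv smooth_D)

lemma ip_has_deriv: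
  assumes "t \<in> I"
  shows "((\<lambda>q. ip a b q t) has_real_derivative v p t * (ip (Suc a) b p t + ip a (Suc b) p t)) (at p)"
proof -
  have "((\<lambda>q. \<Sum>i<n. D a i q t * D b i q t) has_real_derivative
     (\<Sum>i<n. v p t * D (Suc a) i p t * D b i p t + v p t * D (Suc b) i p t * D a i p t)) (at p)"
    by (intro DERIV_sum DERIV_mult D_has_deriv assms) auto
  then show ?thesis
    unfolding ip_def by (simp add: sum.distrib sum_distrib_left algebra_simps)
qed

lemma ip_0_0: "t \<in> I \<Longrightarrow> ip 0 0 p t = 1"
  using speed_sq_pos[of t p]
  by (simp add: ip_def D_0 ds_def v_eq power2_eq_square sum_divide_distrib[symmetric])

lemma ip_0_eq:
  assumes "j \<ge> 1" "t \<in> I"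
  shows "ip 0 j p t = - (\<Sum>(a, b)\<leftarrow>tangential_terms j. ip a b p t)"
  using assms(1)
proof (induction j arbitrary: p rule: nat_induct_at_least)
  case base
  have "((\<lambda>q. ip 0 0 q t) has_real_derivative v p t * (ip 1 0 p t + ip 0 1 p t)) (at p)"
    using ip_has_deriv[OF assms(2), of 0 0] by simp
  moreover have "((\<lambda>q. ip 0 0 q t) has_real_derivative 0) (at p)"
    by (simp add: ip_0_0[OF assms(2)])
  ultimately have "v p t * (ip 1 0 p t + ip 0 1 p t) = 0" by (rule DERIV_unique)
  then show ?case using v_pos[OF assms(2), of p] ip_commute[of 1 0] by simp
next
  case (Suc j)
  let ?S = "\<Sum>(a, b)\<leftarrow>tangential_terms j. ip (Suc a) b p t + ip a (Suc b) p t"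
  have "((\<lambda>q. - (\<Sum>(a, b)\<leftarrow>tangential_terms j. ip a b q t)) has_real_derivative
     - (\<Sum>(a, b)\<leftarrow>tangential_terms j. v p t * (ip (Suc a) b p t + ip a (Suc b) p t))) (at p)"
    unfolding case_prod_beta
    by (intro DERIV_minus has_real_derivative_sum_list ip_has_deriv assms)
  then have "((\<lambda>q. ip 0 j q t) has_real_derivative v p t * - ?S) (at p)"
    using Suc.IH by (simp add: case_prod_beta' sum_list_const_mult)
  from DERIV_unique[OF ip_has_deriv[OF assms(2)] this]
  have "ip 1 j p t + ip 0 (Suc j) p t = - ?S"
    using v_pos[OF assms(2), of p] unfolding mult_cancel_left by simp
  then show ?case using Suc.hyps
    by (simp add: sum_list_concat_map case_prod_beta')
qed

text \<open>
  Time derivatives are used at positive times only, where they are two-sided.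
\<close>
lemma interior_time_window:
  assumes "0 < t" "t \<in> I"
  obtains a b where "0 < a" "t \<in> {a<..<b}" "{a..b} \<subseteq> I"
proof -
  have "ereal t < \<omega>" using assms by (simp add: time_interval_def)
  then obtain b where b: "ereal t < ereal b" "ereal b < \<omega>" using ereal_dense2 by blast
  have "{t/2..b} \<subseteq> I" using assms(1) b(2) by (auto simp: time_interval_def intro: le_less_trans[of _ "ereal b"])
  then show ?thesis using assms(1) b(1) by (intro that[of "t/2" b]) auto
qed

lemma dt_deriv:
  assumes F: "spacetime_smooth I F" and X: "spacetime_smooth I X"
    and dt: "\<And>p t. 0 < t \<Longrightarrow> t \<in> I \<Longrightarrow> (F p has_real_derivative X p t) (at t)"
    and t: "0 < t" "t \<in> I"
  shows "((\<lambda>t. deriv (\<lambda>q. F q t) p) has_real_derivative deriv (\<lambda>q. X q t) p) (at t)"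
proof -
  from interior_time_window[OF t] obtain a b where "0 < a" "t \<in> {a<..<b}" "{a..b} \<subseteq> I" .
  moreover have "(F q has_real_derivative X q s) (at s within {a..b})" if "s \<in> {a..b}" for q s
    using that \<open>0 < a\<close> \<open>{a..b} \<subseteq> I\<close> by (intro has_field_derivative_at_within[OF dt]) auto
  ultimately show ?thesis
    by (intro time_derivative_of_space_derivative[OF F X, of a b])
qed

lemma dt_\<gamma>:
  assumes "i < n" "0 < t" "t \<in> I"
  shows "((\<lambda>\<tau>. \<gamma> p \<tau> i) has_real_derivative D 1 i p t) (at t)"
proof -
  from interior_time_window[OF assms(2,3)] obtain a b where ab: "0 < a" "t \<in> {a<..<b}" "{a..b} \<subseteq> I" .
  have "((\<lambda>\<tau>. \<gamma> p \<tau> i) has_real_derivative D 1 i p t) (at t within I)"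
    using flow assms unfolding curve_shortening_flow_def D_1 by blast
  moreover have "t \<in> interior I"
    using ab interior_maximal[of "{a<..<b}" I] by (auto simp: subset_iff)
  then have "at t within I = at t" by (rule at_within_interior)
  ultimately show ?thesis by simp
qed

text \<open>
  \<open>v \<partial>v/\<partial>t = \<langle>\<gamma>\<^sub>p, \<partial>\<^sub>p D\<^sub>1\<rangle> = v\<^sup>2 \<langle>T, D\<^sub>2\<rangle>\<close>, and \<open>\<langle>T, D\<^sub>2\<rangle> = - |D\<^sub>1|\<^sup>2\<close>.
\<close>
lemma dt_v:
  assumes "0 < t" "t \<in> I"
  shows "(v p has_real_derivative - (ip 1 1 p t * v p t)) (at t)"
proof -
  let ?g = "\<lambda>i t. deriv (\<lambda>q. \<gamma> q t i) p"
  \<comment> \<open>the velocity \<open>D\<^sub>1\<close> is smooth, so \<open>\<partial>\<^sub>t\<close> may be taken inside the space derivative\<close>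
  have g: "(?g i has_real_derivative v p t * D 2 i p t) (at t)" if "i < n" for i
  proof -
    have "(?g i has_real_derivative deriv (\<lambda>q. D 1 i q t) p) (at t)"
      using dt_deriv[OF smooth_\<gamma> smooth_D dt_\<gamma> assms] that by blast
    moreover have "deriv (\<lambda>q. D 1 i q t) p = v p t * D 2 i p t"
      using DERIV_imp_deriv[OF D_has_deriv[OF that assms(2)]] by (simp add: numeral_2_eq_2)
    ultimately show ?thesis by simp
  qed
  have "((\<lambda>t. sqrt (\<Sum>i<n. (?g i t)\<^sup>2)) has_real_derivative
      (\<Sum>i<n. 2 * (v p t * D 2 i p t) * ?g i t) / (2 * v p t)) (at t)"
    using speed_sq_pos[OF assms(2), of p]
    by (auto intro!: derivative_eq_intros g simp: v_eq field_simps)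
  moreover have "(\<Sum>i<n. 2 * (v p t * D 2 i p t) * ?g i t) = 2 * v p t * v p t * ip 0 2 p t"
    unfolding ip_def sum_distrib_left
  proof (rule sum.cong)
    fix i :: nat
    have "?g i t = v p t * D 0 i p t"
      using v_pos[OF assms(2), of p] by (simp add: D_0 ds_def)
    then show "2 * (v p t * D 2 i p t) * ?g i t = 2 * v p t * v p t * (D 0 i p t * D 2 i p t)"
      by simp
  qed simp
  moreover have "ip 0 2 p t = - ip 1 1 p t"
    using ip_0_eq[of 2 t p] assms(2) by (simp add: numeral_2_eq_2)
  moreover have "v p = (\<lambda>t. sqrt (\<Sum>i<n. (?g i t)\<^sup>2))"
    by (intro ext v_eq)
  ultimately show ?thesis
    using v_pos[OF assms(2), of p] by (simp add: mult.commute)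
qed

text \<open>
  The commutator rule \<open>\<partial>\<^sub>t \<partial>\<^sub>s = \<partial>\<^sub>s \<partial>\<^sub>t + \<kappa>\<^sup>2 \<partial>\<^sub>s\<close>, in which \<open>\<kappa>\<^sup>2\<close> comes from the shrinking speed.
\<close>
lemma dt_ds:
  assumes F: "spacetime_smooth I F" and X: "spacetime_smooth I X"
    and dt: "\<And>p t. 0 < t \<Longrightarrow> t \<in> I \<Longrightarrow> (F p has_real_derivative X p t) (at t)"
    and t: "0 < t" "t \<in> I"
  shows "(ds F p has_real_derivative ds X p t + ip 1 1 p t * ds F p t) (at t)"
  using v_pos[OF t(2), of p] unfolding ds_def[abs_def]
  by (auto intro!: derivative_eq_intros dt_deriv[OF F X dt t] dt_v[OF t] simp: field_simps)

text \<open>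
  Each further arclength derivative is passed through \<open>\<partial>\<^sub>t\<close> by the commutator rule; \<open>\<gamma>\<close> itself
  starts the induction, because its time derivative is \<open>D\<^sub>1\<close>.
\<close>
lemma dt_D:
  assumes "i < n" "0 < t" "t \<in> I"
  shows "(D j i p has_real_derivative D (j + 2) i p t + reaction j i p t) (at t)"
  using assms(2,3)
proof (induction j arbitrary: p t)
  case 0
  have "(ds (\<lambda>p t. \<gamma> p t i) p has_real_derivative ds (D 1 i) p t + ip 1 1 p t * ds (\<lambda>p t. \<gamma> p t i) p t) (at t)"
    by (rule dt_ds[OF smooth_\<gamma> smooth_D dt_\<gamma>]) (use assms(1) 0 in auto)
  then show ?case by (simp add: D_0 reaction_def D_Suc[symmetric] numeral_2_eq_2)
next
  case (Suc j)
  have "ds (\<lambda>p t. D (j + 2) i p t + reaction j i p t) p t =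
    D (Suc j + 2) i p t + (\<Sum>(a, b, c)\<leftarrow>reaction_terms j.
      (ip (Suc a) b p t + ip a (Suc b) p t) * D c i p t + ip a b p t * D (Suc c) i p t)"
    (is "_ = _ + ?S")
  proof (rule ds_eqI[OF _ Suc.prems(2)])
    have "((\<lambda>q. reaction j i q t) has_real_derivative (\<Sum>(a, b, c)\<leftarrow>reaction_terms j.
      v p t * ((ip (Suc a) b p t + ip a (Suc b) p t) * D c i p t + ip a b p t * D (Suc c) i p t))) (at p)"
      unfolding reaction_def case_prod_beta
      by (rule has_real_derivative_sum_list)
        (auto intro!: derivative_eq_intros ip_has_deriv D_has_deriv assms(1) Suc.prems simp: algebra_simps)
    then have "((\<lambda>q. reaction j i q t) has_real_derivative v p t * ?S) (at p)"
      by (simp add: case_prod_beta' sum_list_const_mult)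
    from DERIV_add[OF D_has_deriv[OF assms(1) Suc.prems(2), of "j + 2"] this]
    show "((\<lambda>q. D (j + 2) i q t + reaction j i q t) has_real_derivative
        v p t * (D (Suc j + 2) i p t + ?S)) (at p)"
      by (simp add: algebra_simps)
  qed
  moreover have "reaction (Suc j) i p t = ?S + ip 1 1 p t * D (Suc j) i p t"
    by (simp add: reaction_def sum_list_concat_map case_prod_beta' algebra_simps)
  moreover have "(D (Suc j) i p has_real_derivative
      ds (\<lambda>p t. D (j + 2) i p t + reaction j i p t) p t + ip 1 1 p t * D (Suc j) i p t) (at t)"
    unfolding D_Suc
    using Suc.prems assms(1)
    by (intro dt_ds spacetime_smooth_add smooth_D smooth_reaction Suc.IH)
  ultimately show ?case by (simp add: add.assoc)
qed

definition reaction_ip :: "nat \<Rightarrow> real \<Rightarrow> real \<Rightarrow> real" where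
  "reaction_ip j p t = (\<Sum>(a, b, c)\<leftarrow>reaction_terms j. ip a b p t * ip c j p t)"

lemma dt_ip:
  assumes "0 < t" "t \<in> I"
  shows "(ip j j p has_real_derivative 2 * ip (j + 2) j p t + 2 * reaction_ip j p t) (at t)"
proof -
  have "(\<Sum>i<n. (\<Sum>(a, b, c)\<leftarrow>xs. ip a b p t * D c i p t) * D j i p t)
     = (\<Sum>(a, b, c)\<leftarrow>xs. ip a b p t * ip c j p t)" for xs
    by (induction xs) (auto simp: algebra_simps sum.distrib ip_def[of _ j] sum_distrib_left)
  then have *: "(\<Sum>i<n. reaction j i p t * D j i p t) = reaction_ip j p t"
    by (simp add: reaction_def reaction_ip_def)
  have "((\<lambda>t. \<Sum>i<n. D j i p t * D j i p t) has_real_derivative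
     (\<Sum>i<n. (D (j + 2) i p t + reaction j i p t) * D j i p t + (D (j + 2) i p t + reaction j i p t) * D j i p t)) (at t)"
    by (intro DERIV_sum DERIV_mult dt_D assms) auto
  also have "(\<Sum>i<n. (D (j + 2) i p t + reaction j i p t) * D j i p t + (D (j + 2) i p t + reaction j i p t) * D j i p t)
     = 2 * ip (j + 2) j p t + 2 * reaction_ip j p t"
    by (simp add: algebra_simps sum.distrib ip_def flip: * sum_distrib_left)
  finally show ?thesis by (simp add: ip_def[abs_def])
qed

lemma \<gamma>_periodic: "t \<in> I \<Longrightarrow> \<gamma> (p + 2 * pi) t = \<gamma> p t"
  using flow unfolding curve_shortening_flow_def smooth_immersion_family_def by blast

lemma deriv_periodic:
  fixes f :: "real \<Rightarrow> real"
  assumes "\<And>p. f (p + c) = f p"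
  shows "deriv f (p + c) = deriv f p"
  using DERIV_shift[of f _ p c] assms by (simp add: deriv_def)

lemma v_periodic: "t \<in> I \<Longrightarrow> v (p + 2 * pi) t = v p t"
  by (simp add: v_eq deriv_periodic \<gamma>_periodic)

lemma ds_periodic:
  "t \<in> I \<Longrightarrow> (\<And>p. F (p + 2 * pi) t = F p t) \<Longrightarrow> ds F (p + 2 * pi) t = ds F p t"
  unfolding ds_def by (simp add: v_periodic deriv_periodic[of "\<lambda>q. F q t"])

lemma D_periodic: "t \<in> I \<Longrightarrow> D j i (p + 2 * pi) t = D j i p t"
  by (induction j arbitrary: p) (simp_all only: D_0 D_Suc \<gamma>_periodic ds_periodic)

lemma ip_periodic: "t \<in> I \<Longrightarrow> ip a b (p + 2 * pi) t = ip a b p t"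
  by (simp add: ip_def D_periodic)

lemma ip_Cauchy_Schwarz: "\<bar>ip a b p t\<bar> \<le> sqrt (ip a a p t) * sqrt (ip b b p t)"
proof -
  have "(ip a b p t)\<^sup>2 \<le> ip a a p t * ip b b p t"
    using Cauchy_Schwarz_ineq_sum[of "\<lambda>i. D a i p t" "\<lambda>i. D b i p t" "{..<n}"]
    by (simp add: ip_def power2_eq_square)
  from real_sqrt_le_mono[OF this] show ?thesis by (simp add: real_sqrt_mult)
qed

end

section \<open>Interpolation of the quartic terms\<close>

lemma young_inequality_sq:
  fixes x y \<epsilon> :: real
  assumes "\<epsilon> > 0"
  shows "x * y \<le> \<epsilon> * x\<^sup>2 + y\<^sup>2 / \<epsilon>"
proof -
  have "0 \<le> (\<epsilon> * x - y)\<^sup>2 + (\<epsilon> * x)\<^sup>2 + y\<^sup>2" by simp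
  then have "\<epsilon> * (x * y) \<le> \<epsilon> * (\<epsilon> * x\<^sup>2 + y\<^sup>2 / \<epsilon>)"
    using assms by (simp add: power2_eq_square algebra_simps)
  with assms show ?thesis by (simp only: mult_le_cancel_left_pos)
qed

text \<open>
  The sum of the constants that arise in the different cases of \<open>quartic_interpolation_sorted\<close>, so
  that one constant serves for all of them.
\<close>
definition interpolation_const :: "real \<Rightarrow> real \<Rightarrow> real" where
  "interpolation_const C \<epsilon> = 1 + C + C\<^sup>2 + C ^ 3 + C ^ 3 / \<epsilon>"

context
  fixes x :: "nat \<Rightarrow> real" and m :: nat and C K t :: real
  assumes pos: "0 \<le> C" "0 \<le> K" "0 < t" "K * t \<le> 1"
    and decay: "\<And>j. 1 \<le> j \<Longrightarrow> j < m \<Longrightarrow> (x j)\<^sup>2 \<le> C * K / t ^ (j - 1)"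
begin

lemma triple_product_decay:
  assumes "1 \<le> b" "b < m" "1 \<le> c" "c < m" "1 \<le> d" "d < m"
  shows "(x b * x c * x d)\<^sup>2 \<le> C ^ 3 * K ^ 3 / t ^ (b + c + d - 3)"
proof -
  have "(x b)\<^sup>2 * (x c)\<^sup>2 * (x d)\<^sup>2 \<le> (C * K / t ^ (b - 1)) * (C * K / t ^ (c - 1)) * (C * K / t ^ (d - 1))"
    using pos by (intro mult_mono decay assms) auto
  also have "\<dots> = C ^ 3 * K ^ 3 / (t ^ (b - 1) * t ^ (c - 1) * t ^ (d - 1))"
    by (simp add: power3_eq_cube)
  also have "t ^ (b - 1) * t ^ (c - 1) * t ^ (d - 1) = t ^ (b + c + d - 3)"
    unfolding power_add[symmetric] by (rule arg_cong[where f = "(^) t"]) (use assms in auto)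
  finally show ?thesis by (simp add: power_mult_distrib)
qed

text \<open>
  For small times, a surplus factor \<open>K\<close> can be traded for \<open>1 / t\<close>.
\<close>
lemma cubic_le_quadratic:
  assumes "2 \<le> m"
  shows "K ^ 3 / t ^ (m - 2) \<le> K\<^sup>2 / t ^ (m - 1)"
proof -
  have "m - 1 = Suc (m - 2)" using assms by simp
  then have "K ^ 3 / t ^ (m - 2) = (K * t) * (K\<^sup>2 / t ^ (m - 1))"
    using pos(3) by (simp add: power2_eq_square power3_eq_cube)
  also have "\<dots> \<le> 1 * (K\<^sup>2 / t ^ (m - 1))"
    using pos by (intro mult_right_mono) auto
  finally show ?thesis by simp
qed

text \<open>
  Here \<open>x j\<close> stands for \<open>|D\<^sub>j|\<close>, and \<open>a\<close> is the largest index. The weight condition leaves four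
  cases: \<open>a = m + 1\<close> with the others below \<open>m\<close>; exactly two indices \<open>m\<close> and two indices \<open>1\<close>; exactly
  one index \<open>m\<close> and the others below; all below \<open>m\<close>. Young's inequality separates the factor of
  unknown size in the first and third case, with weights \<open>\<epsilon>\<close> and \<open>1 / t\<close>.
\<close>
lemma quartic_interpolation_sorted:
  assumes m: "2 \<le> m" and \<epsilon>: "0 < \<epsilon>"
    and idx: "1 \<le> b" "1 \<le> c" "1 \<le> d" "b \<le> a" "c \<le> a" "d \<le> a" "a \<le> m + 1"
    and weight: "a + b + c + d = 2 * m + 2"
  shows "x a * x b * x c * x d \<le> \<epsilon> * (x (m + 1))\<^sup>2 + interpolation_const C \<epsilon> / t * (x m)\<^sup>2
     + interpolation_const C \<epsilon> * (K\<^sup>2 / t ^ (m - 1))"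
proof -
  define B where "B = interpolation_const C \<epsilon>"
  have B: "1 + C \<le> B" "C\<^sup>2 \<le> B" "C ^ 3 \<le> B" "C ^ 3 / \<epsilon> \<le> B" "0 \<le> B"
    using pos(1) \<epsilon> by (auto simp: B_def interpolation_const_def)
  have nn: "0 \<le> \<epsilon> * (x (m + 1))\<^sup>2" "0 \<le> B / t * (x m)\<^sup>2" "0 \<le> K\<^sup>2 / t ^ (m - 1)"
    "0 \<le> B * (K\<^sup>2 / t ^ (m - 1))"
    using \<epsilon> pos B(5) by auto
  have scale: "r * (K ^ 3 / t ^ (m - 2)) \<le> B * (K\<^sup>2 / t ^ (m - 1))" if "r \<le> B" for r
    using mult_mono[OF that cubic_le_quadratic[OF m] B(5)] pos by simp
  have "x a * x b * x c * x d \<le> \<epsilon> * (x (m + 1))\<^sup>2 + B / t * (x m)\<^sup>2 + B * (K\<^sup>2 / t ^ (m - 1))"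
  proof (cases "a = m + 1")
    case True
    then have "b + c + d = m + 1" "b < m" "c < m" "d < m" using weight idx by auto
    then have P: "(x b * x c * x d)\<^sup>2 \<le> C ^ 3 * K ^ 3 / t ^ (m - 2)"
      using triple_product_decay[of b c d] idx m by (simp add: numeral_eq_Suc)
    have "x a * (x b * x c * x d) \<le> \<epsilon> * (x a)\<^sup>2 + (x b * x c * x d)\<^sup>2 / \<epsilon>"
      by (rule young_inequality_sq[OF \<epsilon>])
    also have "(x b * x c * x d)\<^sup>2 / \<epsilon> \<le> (C ^ 3 * K ^ 3 / t ^ (m - 2)) / \<epsilon>"
      using P \<epsilon> by (intro divide_right_mono) auto
    also have "\<dots> = (C ^ 3 / \<epsilon>) * (K ^ 3 / t ^ (m - 2))" by simp
    also have "\<dots> \<le> B * (K\<^sup>2 / t ^ (m - 1))" by (rule scale[OF B(4)])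
    finally show ?thesis using nn True by (simp add: mult.assoc)
  next
    case a_le: False
    have sq_bound: "x m * x m * (x 1 * x 1) \<le> B / t * (x m)\<^sup>2"
    proof -
      have "(x 1)\<^sup>2 \<le> C * K" using decay[of 1] m by simp
      also have "\<dots> \<le> B / t"
        using pos B(1) mult_left_mono[OF pos(4,1)] by (simp add: field_simps)
      finally have "(x m)\<^sup>2 * (x 1)\<^sup>2 \<le> (x m)\<^sup>2 * (B / t)" by (intro mult_left_mono) auto
      then show ?thesis by (simp add: power2_eq_square mult_ac)
    qed
    show ?thesis
    proof (cases "a = m")
      case True
      consider "b = m" "c = 1" "d = 1" | "c = m" "b = 1" "d = 1" | "d = m" "b = 1" "c = 1"
        | "b < m" "c < m" "d < m"
        using weight idx True by linarith
      then show ?thesis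
      proof cases
        case 4
        have "b + c + d = m + 2" using weight True by simp
        then have P: "(x b * x c * x d)\<^sup>2 \<le> C ^ 3 * K ^ 3 / t ^ (m - 1)"
          using triple_product_decay[of b c d] idx 4 by (simp add: numeral_eq_Suc)
        have "x a * (x b * x c * x d) \<le> (1 / t) * (x a)\<^sup>2 + (x b * x c * x d)\<^sup>2 / (1 / t)"
          using pos by (intro young_inequality_sq) auto
        also have "(x b * x c * x d)\<^sup>2 / (1 / t) \<le> t * (C ^ 3 * K ^ 3 / t ^ (m - 1))"
          using mult_right_mono[OF P] pos by (simp add: mult.commute)
        also have "\<dots> = C ^ 3 * (K ^ 3 / t ^ (m - 2))"
        proof -
          have "m - 1 = Suc (m - 2)" using m by simp
          then show ?thesis using pos by simp
        qed
        also have "\<dots> \<le> B * (K\<^sup>2 / t ^ (m - 1))" by (rule scale[OF B(3)])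
        also have "(1 / t) * (x a)\<^sup>2 \<le> B / t * (x m)\<^sup>2"
          unfolding True using B(1) pos by (intro mult_right_mono divide_right_mono) auto
        finally show ?thesis using nn by (simp add: mult.assoc)
      qed (use sq_bound nn True in \<open>auto simp: mult_ac\<close>)
    next
      case False
      with a_le idx have lt: "a < m" "b < m" "c < m" "d < m" by auto
      have "(x a * x b * x c * x d)\<^sup>2 = (x a)\<^sup>2 * (x b * x c * x d)\<^sup>2"
        by (simp add: power_mult_distrib mult.assoc)
      also have "\<dots> \<le> (C * K / t ^ (a - 1)) * (C ^ 3 * K ^ 3 / t ^ (b + c + d - 3))"
        using pos idx lt by (intro mult_mono decay triple_product_decay) auto
      also have "\<dots> = (C * C ^ 3) * (K * K ^ 3) / (t ^ (a - 1) * t ^ (b + c + d - 3))" by simp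
      also have "t ^ (a - 1) * t ^ (b + c + d - 3) = t ^ ((m - 1) * 2)"
        unfolding power_add[symmetric] by (rule arg_cong[where f = "(^) t"]) (use weight idx in auto)
      also have "(C * C ^ 3) * (K * K ^ 3) / t ^ ((m - 1) * 2) = (C\<^sup>2 * (K\<^sup>2 / t ^ (m - 1)))\<^sup>2"
        by (simp only: power_mult power_mult_distrib power_divide power2_eq_square power3_eq_cube
            mult_ac times_divide_eq_right times_divide_eq_left divide_divide_eq_left)
      finally have "x a * x b * x c * x d \<le> C\<^sup>2 * (K\<^sup>2 / t ^ (m - 1))"
        by (rule power2_le_imp_le) (use pos in auto)
      also have "\<dots> \<le> B * (K\<^sup>2 / t ^ (m - 1))" by (intro mult_right_mono B nn)
      finally show ?thesis using nn by simp
    qed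
  qed
  then show ?thesis by (simp add: B_def)
qed

lemma quartic_interpolation:
  assumes m: "2 \<le> m" and \<epsilon>: "0 < \<epsilon>"
    and idx: "a \<in> {1..m + 1}" "b \<in> {1..m + 1}" "c \<in> {1..m + 1}" "d \<in> {1..m + 1}"
    and weight: "a + b + c + d = 2 * m + 2"
  shows "x a * x b * x c * x d \<le> \<epsilon> * (x (m + 1))\<^sup>2 + interpolation_const C \<epsilon> / t * (x m)\<^sup>2
     + interpolation_const C \<epsilon> * (K\<^sup>2 / t ^ (m - 1))"
    (is "_ \<le> ?Q")
proof -
  note srt = quartic_interpolation_sorted[OF m \<epsilon>]
  consider "b \<le> a" "c \<le> a" "d \<le> a" | "a \<le> b" "c \<le> b" "d \<le> b"
    | "a \<le> c" "b \<le> c" "d \<le> c" | "a \<le> d" "b \<le> d" "c \<le> d" by linarith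
  then show ?thesis
  proof cases
    case 1
    then show ?thesis using idx weight by (intro srt) auto
  next
    case 2
    then have "x b * x a * x c * x d \<le> ?Q" using idx weight by (intro srt) auto
    then show ?thesis by (simp add: mult_ac)
  next
    case 3
    then have "x c * x a * x b * x d \<le> ?Q" using idx weight by (intro srt) auto
    then show ?thesis by (simp add: mult_ac)
  next
    case 4
    then have "x d * x a * x b * x c \<le> ?Q" using idx weight by (intro srt) auto
    then show ?thesis by (simp add: mult_ac)
  qed
qed

end

section \<open>Differential inequalities for the squared derivatives\<close>

text \<open>
  A bound for the number of quartic products in \<open>\<langle>E\<^sub>m, D\<^sub>m\<rangle>\<close> after each \<open>\<langle>T, D\<^sub>m\<rangle>\<close> has been expanded.
\<close>
definition reaction_count :: "nat \<Rightarrow> real" where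
  "reaction_count m = real (length (reaction_terms m)) * (1 + real (length (tangential_terms m)))"

lemma reaction_count_nonneg: "0 \<le> reaction_count m"
  by (simp add: reaction_count_def)

lemma sum_list_abs_le:
  fixes f :: "'a \<Rightarrow> real"
  assumes "\<And>x. x \<in> set xs \<Longrightarrow> \<bar>f x\<bar> \<le> q"
  shows "\<bar>\<Sum>x\<leftarrow>xs. f x\<bar> \<le> real (length xs) * q"
  using assms
proof (induction xs)
  case (Cons y ys)
  then have "\<bar>f y\<bar> \<le> q" "\<bar>\<Sum>x\<leftarrow>ys. f x\<bar> \<le> real (length ys) * q" by auto
  then show ?case by (simp add: algebra_simps)
qed simp

text \<open>
  The weight \<open>\<epsilon>\<close> is chosen so that all reaction terms together take up only one of the two good
  terms \<open>- u\<^sub>m\<^sub>+\<^sub>1\<close>; the summand \<open>1\<close> keeps the divisor positive.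
\<close>
definition dissipation_const :: "nat \<Rightarrow> real \<Rightarrow> real" where
  "dissipation_const m C =
     2 * (reaction_count m + 1) * interpolation_const C (1 / (2 * (reaction_count m + 1)))"

text \<open>
  With \<open>A = 1 + B\<close>, the first summand comes from the value of \<open>A u\<^sub>m\<^sub>-\<^sub>1\<close> at time \<open>t/2\<close> and the second
  from its growth until time \<open>t\<close>; the power of two is the price of starting at \<open>t/2\<close>.
\<close>
definition decay_const :: "nat \<Rightarrow> real \<Rightarrow> real \<Rightarrow> real" where
  "decay_const m C B = ((1 + B) * C + (B + (1 + B) * B * C + (1 + B) * B)) * 2 ^ (m - 1)"

context closed_curve_flow
begin

text \<open>
  Replacing \<open>\<langle>T, D\<^sub>m\<rangle>\<close> by its expansion removes the index \<open>0\<close>, so that every term is a product of two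
  inner products with positive indices, to which the Cauchy-Schwarz inequality applies.
\<close>
lemma reaction_ip_bound:
  assumes t: "t \<in> I" and m: "1 \<le> m" and q: "0 \<le> q"
    and bound: "\<And>a b c d. a \<in> {1..m + 1} \<Longrightarrow> b \<in> {1..m + 1} \<Longrightarrow> c \<in> {1..m + 1} \<Longrightarrow> d \<in> {1..m + 1}
      \<Longrightarrow> a + b + c + d = 2 * m + 2 \<Longrightarrow>
      sqrt (ip a a p t) * sqrt (ip b b p t) * sqrt (ip c c p t) * sqrt (ip d d p t) \<le> q"
  shows "\<bar>reaction_ip m p t\<bar> \<le> reaction_count m * q"
proof -
  have pair: "\<bar>ip a b p t * ip c d p t\<bar> \<le> q"
    if "a \<in> {1..m + 1}" "b \<in> {1..m + 1}" "c \<in> {1..m + 1}" "d \<in> {1..m + 1}" "a + b + c + d = 2 * m + 2"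
    for a b c d
  proof -
    have "\<bar>ip a b p t * ip c d p t\<bar> \<le>
      (sqrt (ip a a p t) * sqrt (ip b b p t)) * (sqrt (ip c c p t) * sqrt (ip d d p t))"
      unfolding abs_mult by (intro mult_mono ip_Cauchy_Schwarz) (auto simp: ip_nonneg)
    with bound[OF that] show ?thesis by (simp add: mult.assoc)
  qed
  let ?l = "real (length (tangential_terms m))"
  have "\<bar>ip a b p t * ip c m p t\<bar> \<le> (1 + ?l) * q" if "(a, b, c) \<in> set (reaction_terms m)" for a b c
  proof (cases "c = 0")
    case True
    with reaction_terms_weight[OF that] have ab: "1 \<le> a" "1 \<le> b" "a + b = m + 2" by auto
    have "\<bar>ip a b p t * ip e f p t\<bar> \<le> q" if "(e, f) \<in> set (tangential_terms m)" for e f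
      using tangential_terms_weight[OF that] ab by (intro pair) auto
    then have "\<bar>\<Sum>(e, f)\<leftarrow>tangential_terms m. ip a b p t * ip e f p t\<bar> \<le> ?l * q"
      by (intro sum_list_abs_le) auto
    moreover have "ip a b p t * ip c m p t = - (\<Sum>(e, f)\<leftarrow>tangential_terms m. ip a b p t * ip e f p t)"
      unfolding True ip_0_eq[OF m t] by (simp add: case_prod_beta' sum_list_const_mult)
    ultimately show ?thesis using q by (simp add: algebra_simps)
  next
    case False
    with reaction_terms_weight[OF that] m have "\<bar>ip a b p t * ip c m p t\<bar> \<le> q"
      by (intro pair) auto
    also have "\<dots> \<le> (1 + ?l) * q" using q by (simp add: algebra_simps)
    finally show ?thesis .
  qed
  then have "\<bar>reaction_ip m p t\<bar> \<le> real (length (reaction_terms m)) * ((1 + ?l) * q)"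
    unfolding reaction_ip_def by (intro sum_list_abs_le) auto
  then show ?thesis by (simp add: reaction_count_def mult.assoc)
qed

text \<open>
  The value of \<open>\<partial>\<^sub>t u\<^sub>j - \<partial>\<^sub>s\<^sup>2 u\<^sub>j\<close>, by \<open>dt_ip\<close> and \<open>\<partial>\<^sub>s\<^sup>2 u\<^sub>j = 2 \<langle>D\<^sub>j\<^sub>+\<^sub>2, D\<^sub>j\<rangle> + 2 u\<^sub>j\<^sub>+\<^sub>1\<close>.
\<close>
definition heat_defect :: "nat \<Rightarrow> real \<Rightarrow> real \<Rightarrow> real" where
  "heat_defect j p t = 2 * reaction_ip j p t - 2 * ip (Suc j) (Suc j) p t"

text \<open>
  At a spatial maximum of \<open>\<alpha> u\<^sub>i + \<beta> u\<^sub>j - g\<close> its second arclength derivative is nonpositive, so its time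
  derivative is bounded by the terms that are left when each \<open>\<partial>\<^sub>t u\<^sub>k\<close> is replaced by \<open>heat_defect k\<close>.
\<close>
lemma maximum_principle_weighted:
  assumes ab: "0 \<le> a" "{a..b} \<subseteq> I"
    and cont: "continuous_on {a..b} \<alpha>" "continuous_on {a..b} g"
    and deriv: "\<And>s. a < s \<Longrightarrow> s \<le> b \<Longrightarrow> (\<alpha> has_real_derivative \<alpha>' s) (at s)"
      "\<And>s. a < s \<Longrightarrow> s \<le> b \<Longrightarrow> (g has_real_derivative g' s) (at s)"
    and init: "\<And>p. \<alpha> a * ip i i p a + \<beta> * ip j j p a \<le> g a"
    and ineq: "\<And>p s. a < s \<Longrightarrow> s \<le> b \<Longrightarrow> \<alpha> s * ip i i p s + \<beta> * ip j j p s > g s \<Longrightarrow>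
      \<alpha>' s * ip i i p s + \<alpha> s * heat_defect i p s + \<beta> * heat_defect j p s - g' s
        \<le> \<Lambda> * (\<alpha> s * ip i i p s + \<beta> * ip j j p s - g s)"
    and t: "t \<in> {a..b}"
  shows "\<alpha> t * ip i i p t + \<beta> * ip j j p t \<le> g t"
proof -
  let ?f = "\<lambda>p s. \<alpha> s * ip i i p s + \<beta> * ip j j p s - g s"
  have "?f p t \<le> 0"
  proof (rule periodic_maximum_principle[where f = ?f and a = a and b = b and \<Lambda> = \<Lambda>])
    have snd: "snd ` (UNIV \<times> {a..b} :: (real \<times> real) set) \<subseteq> {a..b}" by auto
    show "continuous_on (UNIV \<times> {a..b}) (\<lambda>x. ?f (fst x) (snd x))"
      by (intro continuous_intros continuous_on_compose2[OF cont(1) _ snd]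
          continuous_on_compose2[OF cont(2) _ snd]
          continuous_on_subset[OF spacetime_smooth_continuous_on[OF smooth_ip]])
        (use ab in auto)
  next
    show "?f (p + 2 * pi) s = ?f p s" if "s \<in> {a..b}" for p s
      using that ab(2) by (simp add: ip_periodic subset_iff)
  next
    show "?f p a \<le> 0" for p using init by simp
  next
    fix p s assume s: "a < s" "s \<le> b" and fpos: "?f p s > 0" and mx: "\<And>q. ?f q s \<le> ?f p s"
    have sI: "0 < s" "s \<in> I" using s ab by auto
    \<comment> \<open>\<open>?L k\<close> is the second arclength derivative of \<open>u\<^sub>k\<close>\<close>
    let ?L = "\<lambda>k. 2 * ip (k + 2) k p s + 2 * ip (k + 1) (k + 1) p s"
    have space1: "((\<lambda>q. ?f q s) has_real_derivative
        v q s * (\<alpha> s * (2 * ip (Suc i) i q s) + \<beta> * (2 * ip (Suc j) j q s))) (at q)" for q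
      using ip_commute[of i "Suc i"] ip_commute[of j "Suc j"]
      by (auto intro!: derivative_eq_intros ip_has_deriv sI simp: algebra_simps)
    have space2: "((\<lambda>q. \<alpha> s * (2 * ip (Suc i) i q s) + \<beta> * (2 * ip (Suc j) j q s))
        has_real_derivative v p s * (\<alpha> s * ?L i + \<beta> * ?L j)) (at p)"
      by (auto intro!: derivative_eq_intros ip_has_deriv sI simp: algebra_simps)
    have nonpos: "\<alpha> s * ?L i + \<beta> * ?L j \<le> 0"
      by (rule second_derivative_nonpos_at_max[OF v_pos[OF sI(2)] space1 space2]) (rule mx)
    let ?T = "\<lambda>k. 2 * ip (k + 2) k p s + 2 * reaction_ip k p s"
    let ?E = "\<alpha>' s * ip i i p s + ?T i * \<alpha> s + \<beta> * ?T j - g' s"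
    have "(?f p has_real_derivative ?E) (at s)"
      by (intro DERIV_diff DERIV_add DERIV_mult DERIV_cmult deriv s dt_ip sI)
    moreover have "?E = \<alpha>' s * ip i i p s + \<alpha> s * heat_defect i p s + \<beta> * heat_defect j p s - g' s
       + (\<alpha> s * ?L i + \<beta> * ?L j)"
      by (simp add: heat_defect_def algebra_simps)
    ultimately show "\<exists>D. (?f p has_real_derivative D) (at s) \<and> D \<le> \<Lambda> * ?f p s"
      using ineq[OF s, of p] nonpos fpos by (intro exI[of _ ?E]) linarith
  qed (rule t)
  then show ?thesis by simp
qed

abbreviation K0 :: real where "K0 \<equiv> max_curvature_sq n \<gamma> 0"

lemma zero_in_I: "0 \<in> I"
  using flow by (simp add: curve_shortening_flow_def time_interval_def zero_ereal_def)

lemma ip_bounded: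
  assumes "{a..b} \<subseteq> I"
  obtains U where "\<And>p t. t \<in> {a..b} \<Longrightarrow> ip i i p t \<le> U"
proof -
  have "compact (({0..2*pi} :: real set) \<times> {a..b})" by (intro compact_Times compact_Icc)
  moreover have "continuous_on ({0..2*pi} \<times> {a..b}) (\<lambda>x. ip i i (fst x) (snd x))"
    by (rule continuous_on_subset[OF spacetime_smooth_continuous_on[OF smooth_ip]]) (use assms in auto)
  ultimately have "compact ((\<lambda>x. ip i i (fst x) (snd x)) ` ({0..2*pi} \<times> {a..b}))"
    by (rule compact_continuous_image[rotated])
  then have "bdd_above ((\<lambda>x. ip i i (fst x) (snd x)) ` ({0..2*pi} \<times> {a..b}))"
    by (intro bounded_imp_bdd_above compact_imp_bounded)
  then obtain U where U: "\<And>x. x \<in> {0..2*pi} \<times> {a..b} \<Longrightarrow> ip i i (fst x) (snd x) \<le> U"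
    unfolding bdd_above_def by blast
  have "ip i i p t \<le> U" if t: "t \<in> {a..b}" for p t
  proof -
    have "ip i i (q + 2 * pi) t = ip i i q t" for q
      using t assms by (intro ip_periodic) auto
    then obtain q where "q \<in> {0..2*pi}" "ip i i q t = ip i i p t"
      using periodic_value_on_fundamental_interval[of "\<lambda>q. ip i i q t" p] by auto
    then show ?thesis using U[of "(q, t)"] t by auto
  qed
  then show ?thesis by (rule that)
qed

lemma curvature_sq: "(curvature n (\<lambda>q. \<gamma> q t) p)\<^sup>2 = ip 1 1 p t"
  by (simp add: curvature_def L2_set_def ip_def sum_nonneg power2_eq_square flip: D_1)

lemma initial_curvature: "ip 1 1 p 0 \<le> K0"
proof -
  obtain U where "\<And>p t. t \<in> {0..0} \<Longrightarrow> ip 1 1 p t \<le> U"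
    using ip_bounded[of 0 0 1] zero_in_I by auto
  then have "bdd_above (range (\<lambda>p. ip 1 1 p 0))" by (auto simp: bdd_above_def)
  then show ?thesis unfolding max_curvature_sq_def curvature_sq by (rule cSUP_upper[OF UNIV_I])
qed

text \<open>
  The two families of estimates that are proved together by induction on \<open>m\<close>: the pointwise bound for
  \<open>u\<^sub>m\<close>, and the differential inequality for \<open>u\<^sub>m\<close> that keeps one good term \<open>- u\<^sub>m\<^sub>+\<^sub>1\<close>.
\<close>
definition decays :: "nat \<Rightarrow> real \<Rightarrow> bool" where
  "decays m C \<longleftrightarrow> (\<forall>t p. 0 < t \<longrightarrow> t \<le> 1 / (8 * K0) \<longrightarrow> t \<in> I \<longrightarrow> ip m m p t \<le> C * K0 / t ^ (m - 1))"

definition dissipates :: "nat \<Rightarrow> real \<Rightarrow> bool" where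
  "dissipates m B \<longleftrightarrow> (\<forall>t p. 0 < t \<longrightarrow> t \<le> 1 / (8 * K0) \<longrightarrow> t \<in> I \<longrightarrow>
     heat_defect m p t \<le> - ip (Suc m) (Suc m) p t + B / t * ip m m p t + B * (K0\<^sup>2 / t ^ (m - 1)))"

lemma small_time:
  assumes "0 < t" "t \<le> 1 / (8 * K0)"
  shows "0 < K0" "8 * K0 * t \<le> 1"
proof -
  have "0 < 1 / (8 * K0)" using assms by linarith
  then show "0 < K0" by (simp add: zero_less_divide_iff)
  then show "8 * K0 * t \<le> 1" using assms(2) by (simp add: field_simps)
qed

lemma decays_mono:
  assumes "decays m C" "C \<le> C'"
  shows "decays m C'"
  unfolding decays_def
proof (intro allI impI)
  fix t p assume t: "0 < t" "t \<le> 1 / (8 * K0)" "t \<in> I"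
  have "ip m m p t \<le> C * K0 / t ^ (m - 1)" using assms(1) t by (simp add: decays_def)
  also have "\<dots> \<le> C' * K0 / t ^ (m - 1)"
    using small_time[OF t(1,2)] t(1) assms(2) by (intro divide_right_mono mult_right_mono) auto
  finally show "ip m m p t \<le> C' * K0 / t ^ (m - 1)" .
qed

lemma dissipates_mono:
  assumes "dissipates m B" "B \<le> B'"
  shows "dissipates m B'"
  unfolding dissipates_def
proof (intro allI impI)
  fix t p assume t: "0 < t" "t \<le> 1 / (8 * K0)" "t \<in> I"
  have "heat_defect m p t \<le> - ip (Suc m) (Suc m) p t + B / t * ip m m p t + B * (K0\<^sup>2 / t ^ (m - 1))"
    using assms(1) t by (simp add: dissipates_def)
  also have "\<dots> \<le> - ip (Suc m) (Suc m) p t + B' / t * ip m m p t + B' * (K0\<^sup>2 / t ^ (m - 1))"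
    using t(1) assms(2)
    by (intro add_mono mult_right_mono divide_right_mono order_refl) (auto simp: ip_nonneg)
  finally show "heat_defect m p t \<le> - ip (Suc m) (Suc m) p t + B' / t * ip m m p t
      + B' * (K0\<^sup>2 / t ^ (m - 1))" .
qed

lemma I_downward: "t \<in> I \<Longrightarrow> 0 \<le> s \<Longrightarrow> s \<le> t \<Longrightarrow> s \<in> I"
  by (auto simp: time_interval_def intro: le_less_trans[of _ "ereal t"])

lemma reaction_ip_1: "t \<in> I \<Longrightarrow> reaction_ip 1 p t = 2 * (ip 1 1 p t)\<^sup>2"
  using ip_0_eq[of 1 t p] by (simp add: reaction_ip_def power2_eq_square)

text \<open>
  Comparison with \<open>g = K / (1 - 4 K s)\<close>, which solves \<open>g' = 4 g\<^sup>2\<close>. Where \<open>u\<^sub>1 > g\<close>, the difference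
  \<open>4 u\<^sub>1\<^sup>2 - 4 g\<^sup>2\<close> is linear in \<open>u\<^sub>1 - g\<close> with a bounded factor, because \<open>u\<^sub>1\<close> is bounded on the compact
  time interval.
\<close>
lemma decays_1: "decays 1 2"
  unfolding decays_def
proof (intro allI impI)
  fix t p assume t: "0 < t" "t \<le> 1 / (8 * K0)" "t \<in> I"
  note K = small_time[OF t(1,2)]
  have sub: "{0..t} \<subseteq> I" using I_downward[OF t(3)] by auto
  obtain U where U: "\<And>p s. s \<in> {0..t} \<Longrightarrow> ip 1 1 p s \<le> U"
    using ip_bounded[OF sub] by blast
  let ?g = "\<lambda>s. K0 / (1 - 4 * K0 * s)"
  have den: "1 - 4 * K0 * s \<ge> 1 / 2" if "s \<le> t" for s
    using mult_left_mono[OF that, of "K0"] K by linarith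
  have g: "?g s \<le> 2 * K0" if "s \<le> t" for s
  proof -
    have "K0 / (1 - 4 * K0 * s) \<le> K0 / (1 / 2)"
      using den[OF that] K(1) by (intro divide_left_mono) auto
    then show ?thesis by simp
  qed
  have "1 * ip 1 1 p t + 0 * ip 1 1 p t \<le> ?g t"
  proof (rule maximum_principle_weighted[where a = 0 and b = t and \<alpha> = "\<lambda>_. 1" and \<alpha>' = "\<lambda>_. 0"
        and g' = "\<lambda>s. 4 * (?g s)\<^sup>2" and \<Lambda> = "4 * (U + 2 * K0)"])
    show "continuous_on {0..t} ?g"
      using den by (intro continuous_intros) force
  next
    fix s assume "0 < s" "s \<le> t"
    with den[of s] have "1 - 4 * K0 * s \<noteq> 0" by auto
    then show "(?g has_real_derivative 4 * (?g s)\<^sup>2) (at s)"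
      by (auto intro!: derivative_eq_intros simp: power2_eq_square)
  next
    fix p s assume s: "0 < s" "s \<le> t" and pos: "1 * ip 1 1 p s + 0 * ip 1 1 p s > ?g s"
    have sI: "s \<in> I" using s sub by auto
    have "heat_defect 1 p s \<le> 4 * (ip 1 1 p s)\<^sup>2"
      using reaction_ip_1[OF sI, of p] ip_nonneg[of 2 p s] by (simp add: heat_defect_def numeral_2_eq_2)
    moreover have "4 * (ip 1 1 p s)\<^sup>2 - 4 * (?g s)\<^sup>2 = 4 * (ip 1 1 p s + ?g s) * (ip 1 1 p s - ?g s)"
      by (simp add: power2_eq_square algebra_simps)
    moreover have "\<dots> \<le> 4 * (U + 2 * K0) * (ip 1 1 p s - ?g s)"
      using U[of s p] g[of s] s pos by (intro mult_right_mono) auto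
    ultimately show "0 * ip 1 1 p s + 1 * heat_defect 1 p s + 0 * heat_defect 1 p s - 4 * (?g s)\<^sup>2
        \<le> 4 * (U + 2 * K0) * (1 * ip 1 1 p s + 0 * ip 1 1 p s - ?g s)"
      by simp
  qed (use sub initial_curvature t in auto)
  with g[of t] show "ip 1 1 p t \<le> 2 * K0 / t ^ (1 - 1)" by simp
qed

lemma dissipates_1: "dissipates 1 8"
  unfolding dissipates_def
proof (intro allI impI)
  fix t p assume t: "0 < t" "t \<le> 1 / (8 * K0)" "t \<in> I"
  note K = small_time[OF t(1,2)]
  have "ip 1 1 p t \<le> 2 * K0" using decays_1 t unfolding decays_def by fastforce
  also have "\<dots> \<le> 2 / t" using K t(1) by (simp add: field_simps)
  finally have "4 * (ip 1 1 p t)\<^sup>2 \<le> 8 / t * ip 1 1 p t"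
    using mult_right_mono[of "ip 1 1 p t" "2 / t" "ip 1 1 p t"] ip_nonneg[of 1 p t]
    by (simp add: power2_eq_square)
  then show "heat_defect 1 p t \<le> - ip (Suc 1) (Suc 1) p t + 8 / t * ip 1 1 p t + 8 * (K0\<^sup>2 / t ^ (1 - 1))"
    using reaction_ip_1[OF t(3), of p] ip_nonneg[of "Suc 1" p t]
    by (simp add: heat_defect_def add_increasing2)
qed

lemma dissipates_if_decays:
  assumes m: "2 \<le> m" and C: "0 \<le> C" and dec: "\<And>j. 1 \<le> j \<Longrightarrow> j < m \<Longrightarrow> decays j C"
  shows "dissipates m (dissipation_const m C)"
  unfolding dissipates_def
proof (intro allI impI)
  fix t p assume t: "0 < t" "t \<le> 1 / (8 * K0)" "t \<in> I"
  note K = small_time[OF t(1,2)]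
  \<comment> \<open>\<open>N\<close> exceeds the number of terms, so that \<open>2 N \<epsilon> = 1\<close> makes the total share of \<open>u\<^sub>m\<^sub>+\<^sub>1\<close> equal to \<open>1\<close>\<close>
  define N where "N = reaction_count m + 1"
  define \<epsilon> where "\<epsilon> = 1 / (2 * N)"
  define A where "A = interpolation_const C \<epsilon>"
  define q where "q = \<epsilon> * ip (m + 1) (m + 1) p t + A / t * ip m m p t + A * (K0\<^sup>2 / t ^ (m - 1))"
  have N: "N > 0" using reaction_count_nonneg[of m] by (simp add: N_def)
  then have \<epsilon>: "\<epsilon> > 0" by (simp add: \<epsilon>_def)
  have A: "A \<ge> 0" using C \<epsilon> by (simp add: A_def interpolation_const_def)
  have q: "q \<ge> 0" using \<epsilon> A t(1) by (simp add: q_def ip_nonneg)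
  have "\<bar>reaction_ip m p t\<bar> \<le> reaction_count m * q"
  proof (rule reaction_ip_bound[OF t(3) _ q])
    fix a b c d
    assume *: "a \<in> {1..m + 1}" "b \<in> {1..m + 1}" "c \<in> {1..m + 1}" "d \<in> {1..m + 1}"
      "a + b + c + d = 2 * m + 2"
    have "(sqrt (ip j j p t))\<^sup>2 \<le> C * K0 / t ^ (j - 1)" if "1 \<le> j" "j < m" for j
      using dec[OF that] t ip_nonneg[of j p t] by (simp add: decays_def)
    moreover have "K0 * t \<le> 1" using K t(1) by (simp add: mult.assoc)
    ultimately show "sqrt (ip a a p t) * sqrt (ip b b p t) * sqrt (ip c c p t) * sqrt (ip d d p t) \<le> q"
      using quartic_interpolation[of C K0 t m "\<lambda>j. sqrt (ip j j p t)" \<epsilon> a b c d] C K t(1) m \<epsilon> *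
      by (simp add: q_def A_def ip_nonneg)
  qed (use m in simp)
  also have "\<dots> \<le> N * q" using q by (intro mult_right_mono) (auto simp: N_def)
  finally have "2 * reaction_ip m p t \<le> 2 * N * q" by simp
  also have "\<dots> = ip (m + 1) (m + 1) p t + 2 * N * A / t * ip m m p t + 2 * N * A * (K0\<^sup>2 / t ^ (m - 1))"
    using N by (simp add: q_def \<epsilon>_def algebra_simps)
  also have "2 * N * A = dissipation_const m C"
    by (simp add: dissipation_const_def N_def A_def \<epsilon>_def)
  finally show "heat_defect m p t \<le> - ip (Suc m) (Suc m) p t
      + dissipation_const m C / t * ip m m p t + dissipation_const m C * (K0\<^sup>2 / t ^ (m - 1))"
    by (simp add: heat_defect_def)
qed

text \<open>
  The maximum principle for \<open>(s - t/2) u\<^sub>m + A u\<^sub>m\<^sub>-\<^sub>1\<close> from \<open>t/2\<close> to \<open>t\<close>. The terms \<open>u\<^sub>m\<close>, from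
  differentiating the weight, and \<open>B u\<^sub>m\<close> are cancelled by \<open>- A u\<^sub>m\<close> with \<open>A = 1 + B\<close>. What remains is of
  order \<open>K / t\<^bsup>m-1\<^esup>\<close>, hence contributes at most order \<open>K / t\<^bsup>m-2\<^esup>\<close> over the time \<open>t/2\<close>; this and the
  initial value of \<open>A u\<^sub>m\<^sub>-\<^sub>1\<close>, which has the same order, are then divided by the weight \<open>t/2\<close>.
\<close>
lemma decays_step:
  assumes m: "2 \<le> m" and pos: "0 \<le> C" "0 \<le> B"
    and dec: "decays (m - 1) C" and dis: "dissipates (m - 1) B" "dissipates m B"
  shows "decays m (decay_const m C B)"
  unfolding decays_def
proof (intro allI impI)
  fix t p assume t: "0 < t" "t \<le> 1 / (8 * K0)" "t \<in> I"
  note K = small_time[OF t(1,2)]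
  obtain k where k: "m = Suc (Suc k)" using m by (metis One_nat_def Suc_1 Suc_le_D add_2_eq_Suc le_Suc_ex)
  define a where "a = t / 2"
  define A where "A = 1 + B"
  define M where "M = B + A * B * C + A * B"
  define \<mu> where "\<mu> = M * (K0 / a ^ Suc k)"
  have a: "0 < a" "a \<le> t" using t by (auto simp: a_def)
  have M: "0 \<le> M" using pos by (simp add: M_def A_def)
  have window: "0 < s" "s \<le> 1 / (8 * K0)" "s \<in> I" "K0 * s \<le> 1" if "a \<le> s" "s \<le> t" for s
  proof -
    show "0 < s" "s \<le> 1 / (8 * K0)" "s \<in> I" using that a t I_downward[OF t(3), of s] by auto
    then show "K0 * s \<le> 1" using small_time[of s] by (simp add: mult.assoc)
  qed
  have "(t - a) * ip m m p t + A * ip (Suc k) (Suc k) p t \<le> A * (C * K0 / a ^ k) + \<mu> * (t - a)"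
  proof (rule maximum_principle_weighted[where a = a and b = t and \<alpha> = "\<lambda>s. s - a"
        and g = "\<lambda>s. A * (C * K0 / a ^ k) + \<mu> * (s - a)"
        and \<alpha>' = "\<lambda>_. 1" and g' = "\<lambda>_. \<mu>" and \<Lambda> = 0])
    show "{a..t} \<subseteq> I" using window by auto
  next
    fix p
    have "ip (Suc k) (Suc k) p a \<le> C * K0 / a ^ k"
      using dec window[of a] a k by (simp add: decays_def)
    then have "A * ip (Suc k) (Suc k) p a \<le> A * (C * K0 / a ^ k)"
      using pos by (intro mult_left_mono) (auto simp: A_def)
    then show "(a - a) * ip m m p a + A * ip (Suc k) (Suc k) p a \<le> A * (C * K0 / a ^ k) + \<mu> * (a - a)"
      by simp
  next
    fix p s assume s: "a < s" "s \<le> t"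
    then have s': "a \<le> s" "s \<le> t" by auto
    note w = window[OF s']
    define u where "u = ip m m p s"
    define y where "y = K0 / s ^ Suc k"
    have u: "u \<ge> 0" by (simp add: u_def ip_nonneg)
    \<comment> \<open>all error terms are brought to the order \<open>y\<close>, using \<open>K s \<le> 1\<close>\<close>
    have z: "K0\<^sup>2 / s ^ k \<le> y"
    proof -
      have "K0\<^sup>2 / s ^ k = (K0 * s) * y" using w(1) by (simp add: y_def power2_eq_square)
      also have "\<dots> \<le> 1 * y" using w K by (intro mult_right_mono) (auto simp: y_def)
      finally show ?thesis by simp
    qed
    have "heat_defect m p s \<le> - ip (Suc m) (Suc m) p s + B / s * u + B * (K0\<^sup>2 / s ^ Suc k)"
      using dis(2) w k by (simp add: dissipates_def u_def)
    also have "\<dots> \<le> (B * u + B * (K0\<^sup>2 / s ^ k)) / s"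
      using ip_nonneg[of "Suc m" p s] by (simp add: add_divide_distrib mult.commute)
    also have "\<dots> \<le> (B * u + B * y) / s"
      using z pos w by (intro divide_right_mono add_left_mono mult_left_mono) auto
    finally have "(s - a) * heat_defect m p s \<le> (s - a) * ((B * u + B * y) / s)"
      using s by (intro mult_left_mono) auto
    also have "\<dots> = ((s - a) / s) * (B * u + B * y)" by simp
    also have "\<dots> \<le> 1 * (B * u + B * y)"
      using s a w K pos u by (intro mult_right_mono) (auto simp: y_def)
    finally have 1: "(s - a) * heat_defect m p s \<le> B * u + B * y" by simp
    have "heat_defect (Suc k) p s \<le> - u + B / s * ip (Suc k) (Suc k) p s + B * (K0\<^sup>2 / s ^ k)"
      using dis(1) w k by (simp add: dissipates_def u_def)
    also have "ip (Suc k) (Suc k) p s \<le> C * K0 / s ^ k"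
      using dec w k by (simp add: decays_def)
    then have "B / s * ip (Suc k) (Suc k) p s \<le> B / s * (C * K0 / s ^ k)"
      using pos w by (intro mult_left_mono) auto
    also have "\<dots> = B * C * y" by (simp add: y_def)
    also have "B * (K0\<^sup>2 / s ^ k) \<le> B * y" using z pos by (intro mult_left_mono)
    finally have "heat_defect (Suc k) p s \<le> - u + B * C * y + B * y" by simp
    then have "A * heat_defect (Suc k) p s \<le> A * (- u + B * C * y + B * y)"
      using pos by (intro mult_left_mono) (auto simp: A_def)
    with 1 have "u + (s - a) * heat_defect m p s + A * heat_defect (Suc k) p s \<le> M * y"
      by (simp add: A_def M_def algebra_simps)
    also have "M * y \<le> \<mu>"
      unfolding \<mu>_def y_def using M K a s' by (intro mult_left_mono divide_left_mono power_mono) auto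
    finally show "1 * ip m m p s + (s - a) * heat_defect m p s + A * heat_defect (Suc k) p s - \<mu>
        \<le> 0 * ((s - a) * ip m m p s + A * ip (Suc k) (Suc k) p s - (A * (C * K0 / a ^ k) + \<mu> * (s - a)))"
      by (simp add: u_def)
  qed (use a in \<open>auto intro!: continuous_intros derivative_eq_intros\<close>)
  moreover have "0 \<le> A * ip (Suc k) (Suc k) p t"
    using pos by (simp add: A_def ip_nonneg)
  moreover have "t - a = a" by (simp add: a_def)
  ultimately have "a * ip m m p t \<le> A * (C * K0 / a ^ k) + \<mu> * a" by simp
  then have "ip m m p t \<le> (A * (C * K0 / a ^ k) + \<mu> * a) / a"
    using a by (simp add: field_simps)
  also have "\<dots> = (A * C + M) * (K0 / a ^ Suc k)"
    using a by (simp add: \<mu>_def field_simps)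
  also have "\<dots> = decay_const m C B * K0 / t ^ (m - 1)"
    by (simp add: decay_const_def k a_def A_def M_def power_divide)
  finally show "ip m m p t \<le> decay_const m C B * K0 / t ^ (m - 1)" .
qed

end

section \<open>Constants that depend on the order only\<close>

text \<open>
  The constants of the previous lemmas are explicit functions of \<open>m\<close> and of earlier constants, so a
  single \<open>C\<close> is fixed before the flow is chosen.
\<close>
lemma uniform_decay:
  assumes "1 \<le> m"
  shows "\<exists>C\<ge>0. \<forall>n \<omega> \<gamma>. closed_curve_flow n \<omega> \<gamma> \<longrightarrow>
    (\<forall>j. 1 \<le> j \<longrightarrow> j \<le> m \<longrightarrow> closed_curve_flow.decays n \<omega> \<gamma> j C)"
  using assms
proof (induction m rule: nat_induct_at_least)
  case base
  have "closed_curve_flow.decays n \<omega> \<gamma> j 2"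
    if "closed_curve_flow n \<omega> \<gamma>" "1 \<le> j" "j \<le> 1" for n \<omega> \<gamma> j
    using closed_curve_flow.decays_1[OF that(1)] that by (simp add: le_antisym)
  then show ?case by (intro exI[of _ 2]) auto
next
  case (Suc m)
  then obtain C where C: "0 \<le> C" and
    dec: "\<And>n \<omega> \<gamma> j. closed_curve_flow n \<omega> \<gamma> \<Longrightarrow> 1 \<le> j \<Longrightarrow> j \<le> m \<Longrightarrow> closed_curve_flow.decays n \<omega> \<gamma> j C"
    by blast
  define B where "B = max 8 (max (dissipation_const m C) (dissipation_const (Suc m) C))"
  define C' where "C' = max C (decay_const (Suc m) C B)"
  have B: "8 \<le> B" "dissipation_const m C \<le> B" "dissipation_const (Suc m) C \<le> B"
    by (auto simp: B_def)
  have "closed_curve_flow.decays n \<omega> \<gamma> j C'"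
    if fl: "closed_curve_flow n \<omega> \<gamma>" and j: "1 \<le> j" "j \<le> Suc m" for n \<omega> \<gamma> j
  proof -
    interpret closed_curve_flow n \<omega> \<gamma> by (rule fl)
    have "dissipates (Suc m) B"
      using dissipates_if_decays[of "Suc m" C] C dec[OF fl] Suc.hyps
      by (intro dissipates_mono[OF _ B(3)]) auto
    \<comment> \<open>for \<open>m = 1\<close> there are no lower derivatives to interpolate with\<close>
    moreover have "dissipates m B"
    proof (cases "m = 1")
      case True
      then show ?thesis using dissipates_mono[OF dissipates_1 B(1)] by simp
    next
      case False
      then show ?thesis
        using dissipates_if_decays[of m C] C dec[OF fl] Suc.hyps
        by (intro dissipates_mono[OF _ B(2)]) auto
    qed
    ultimately have "decays (Suc m) (decay_const (Suc m) C B)"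
      using decays_step[of "Suc m" C B] C B(1) dec[OF fl, of m] Suc.hyps by simp
    then have "decays j C \<or> decays j (decay_const (Suc m) C B)"
      using dec[OF fl, of j] j by (cases "j = Suc m") auto
    then show ?thesis by (auto simp: C'_def intro: decays_mono)
  qed
  moreover have "0 \<le> C'" using C by (simp add: C'_def)
  ultimately show ?case by blast
qed

theorem theorem3p9:
  fixes m :: nat
  assumes "m \<ge> 1"
  shows "\<exists>C::real. \<forall>(n::nat) (\<omega>::ereal) (\<gamma> :: real \<Rightarrow> real \<Rightarrow> nat \<Rightarrow> real).
    n \<ge> 2 \<longrightarrow> curve_shortening_flow n \<omega> \<gamma> \<longrightarrow>
    (\<forall>t p. 0 < t \<longrightarrow> t \<le> 1 / (8 * max_curvature_sq n \<gamma> 0) \<longrightarrow> ereal t < \<omega> \<longrightarrow>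
      (L2_set ((arc_deriv n (\<lambda>q. \<gamma> q t) ^^ m) (unit_tangent n (\<lambda>q. \<gamma> q t)) p) {..<n})\<^sup>2
        \<le> C * max_curvature_sq n \<gamma> 0 / t ^ (m - 1))"
proof -
  from uniform_decay[OF assms] obtain C where
    C: "\<And>n \<omega> \<gamma>. closed_curve_flow n \<omega> \<gamma> \<Longrightarrow> closed_curve_flow.decays n \<omega> \<gamma> m C"
    using assms by blast
  show ?thesis
  proof (intro exI[of _ C] allI impI)
    fix n :: nat and \<omega> :: ereal and \<gamma> :: "real \<Rightarrow> real \<Rightarrow> nat \<Rightarrow> real" and t p :: real
    assume fl: "curve_shortening_flow n \<omega> \<gamma>"
      and t: "0 < t" "t \<le> 1 / (8 * max_curvature_sq n \<gamma> 0)" "ereal t < \<omega>"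
    interpret closed_curve_flow n \<omega> \<gamma> by unfold_locales (rule fl)
    have "t \<in> I" using t by (simp add: time_interval_def)
    then have "ip m m p t \<le> C * K0 / t ^ (m - 1)"
      using C[OF closed_curve_flow_axioms] t by (simp add: decays_def)
    then show "(L2_set ((arc_deriv n (\<lambda>q. \<gamma> q t) ^^ m) (unit_tangent n (\<lambda>q. \<gamma> q t)) p) {..<n})\<^sup>2
        \<le> C * K0 / t ^ (m - 1)"
      by (simp add: L2_set_def ip_def D_def sum_nonneg power2_eq_square)
  qed
qed

end
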